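(* There is an algorithm that, given any positive integer $d$, any positive integer $n$, any $1\le p\le\infty$, and any nonnegative integer weights $w^1,\dots,w^d$ on $N=\{(i,j):1\le i,j\le n\}$, determines a $d^{1/p}$-approximative solution to the maximum nonlinear bipartite matching problem with $f=\|\cdot\|_p$ (maximizing $\|(w^1(M),\dots,w^d(M))\|_p$ over perfect matchings $M\subset N$ of $K_{n,n}$), in oracle-time which is polynomial in $d$, $n$, and $\max_{i,j,k}\lceil\log w^k_{i,j}\rceil$. (Here $d$ is part of the input and not fixed, and $d^{1/\infty}=1$.)
   Context: $N=\{(i,j):1\le i,j\le n\}$ is the edge set of the complete bipartite graph $K_{n,n}$. For a weight function $w^k$ on $N$ write $w^k_{i,j}=w^k(i,j)$, and for $M\subseteq N$ let $w^k(M):=\sum\{w^k(i,j):(i,j)\in M\}$. The quantity $\max\lceil\log w^k_{i,j}\rceil$ measures the bit size of the weights. The $l_p$ norm on $\mathbb{R}^d$ is $\|y\|_p=(\sum_{k=1}^d|y_k|^p)^{1/p}$ for $1\le p<\infty$ and $\|y\|_\infty=\max_{k=1}^d|y_k|$. The function $f=\|\cdot\|_p$ is presented by a comparison oracle that, queried on $y,z\in\mathbb{Z}^d$, asserts whether or not $f(y)\le f(z)$. Oracle-time means the running time plus the number of oracle queries. For a discrete optimization problem with finite set $S$ of feasible solutions and nonnegative objective function $g:S\to\mathbb{R}_+$ to be minimized or maximized, with optimal solution $s^*\in S$, an $r$-approximative solution is any $s\in S$ satisfying $\frac1r g(s^* )\le g(s)\le r\,g(s^* )$. *)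

theory Defs
  imports Complex_Main "HOL-Library.Extended_Real" "HOL-Library.Log_Nat"
begin

section \<open>Oracle programs with logarithmic cost\<close>

text \<open>
  Algorithms are programs of a structured random access machine over the integers with a
  comparison oracle. The memory consists of arrays of integers, each addressed by integers; a
  program mentions only finitely many of them, and a scalar variable is an array used at index 0
  only. Time is charged by the logarithmic cost criterion (every operation pays for the binary
  lengths of its operands, including addresses), so running time agrees with Turing machine time
  up to a polynomial.
\<close>

type_synonym vname = string
type_synonym state = "vname \<Rightarrow> int \<Rightarrow> int"

datatype aexp =
    Const int
  | Elem vname aexp
  | Add aexp aexp
  | Sub aexp aexp
  | Mul aexp aexp

datatype bexp =
    Less aexp aexp
  | Neg bexp
  | Conj bexp bexp

datatype com =
    Skip
  | Assign vname aexp aexp  \<comment> \<open>\<open>Assign x e a\<close> is \<open>x[e] := a\<close>\<close>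
  | Seq com com
  | Cond bexp com com
  | While bexp com
  | Query vname vname vname  \<comment> \<open>\<open>Query x a b\<close> is \<open>x[0] := (if f(a) \<le> f(b) then 1 else 0)\<close>\<close>

text \<open>One sign bit and the binary digits of the absolute value.\<close>

definition bits :: "int \<Rightarrow> nat" where
  "bits z = 1 + floorlog 2 (nat \<bar>z\<bar>)"

primrec aval :: "aexp \<Rightarrow> state \<Rightarrow> int" where
  "aval (Const c) s = c"
| "aval (Elem x e) s = s x (aval e s)"
| "aval (Add a b) s = aval a s + aval b s"
| "aval (Sub a b) s = aval a s - aval b s"
| "aval (Mul a b) s = aval a s * aval b s"

primrec bval :: "bexp \<Rightarrow> state \<Rightarrow> bool" where
  "bval (Less a b) s \<longleftrightarrow> aval a s < aval b s"
| "bval (Neg b) s \<longleftrightarrow> \<not> bval b s"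
| "bval (Conj b c) s \<longleftrightarrow> bval b s \<and> bval c s"

primrec acost :: "aexp \<Rightarrow> state \<Rightarrow> nat" where
  "acost (Const c) s = bits c"
| "acost (Elem x e) s = acost e s + bits (aval e s) + bits (s x (aval e s))"
| "acost (Add a b) s = acost a s + acost b s + bits (aval a s) + bits (aval b s)"
| "acost (Sub a b) s = acost a s + acost b s + bits (aval a s) + bits (aval b s)"
| "acost (Mul a b) s = acost a s + acost b s + bits (aval a s) * bits (aval b s)"

primrec bcost :: "bexp \<Rightarrow> state \<Rightarrow> nat" where
  "bcost (Less a b) s = 1 + acost a s + acost b s"
| "bcost (Neg b) s = 1 + bcost b s"
| "bcost (Conj b c) s = 1 + bcost b s + bcost c s"

text \<open>
  \<open>exec d leq c s t q s'\<close>: started in state \<open>s\<close>, the program \<open>c\<close> halts in state \<open>s'\<close> with running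
  time \<open>t\<close> and \<open>q\<close> oracle queries. The oracle \<open>leq\<close> compares integer vectors of dimension \<open>d\<close>; a
  query \<open>Query x a b\<close> hands over the entries with indices \<open>1, \<dots>, d\<close> of the arrays \<open>a\<close> and \<open>b\<close>, and
  writing down these entries is charged to the running time.
\<close>

inductive exec ::
  "nat \<Rightarrow> ((nat \<Rightarrow> int) \<Rightarrow> (nat \<Rightarrow> int) \<Rightarrow> bool) \<Rightarrow> com \<Rightarrow> state \<Rightarrow> nat \<Rightarrow> nat \<Rightarrow> state \<Rightarrow> bool"
  for d :: nat and leq :: "(nat \<Rightarrow> int) \<Rightarrow> (nat \<Rightarrow> int) \<Rightarrow> bool"
where
  Skip: "exec d leq Skip s 1 0 s"
| Assign: "exec d leq (Assign x e a) s (1 + acost e s + acost a s) 0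
     (s(x := (s x)(aval e s := aval a s)))"
| Seq: "exec d leq c1 s t1 q1 s1 \<Longrightarrow> exec d leq c2 s1 t2 q2 s2 \<Longrightarrow>
     exec d leq (Seq c1 c2) s (t1 + t2) (q1 + q2) s2"
| CondTrue: "bval b s \<Longrightarrow> exec d leq c1 s t q s' \<Longrightarrow>
     exec d leq (Cond b c1 c2) s (1 + bcost b s + t) q s'"
| CondFalse: "\<not> bval b s \<Longrightarrow> exec d leq c2 s t q s' \<Longrightarrow>
     exec d leq (Cond b c1 c2) s (1 + bcost b s + t) q s'"
| WhileFalse: "\<not> bval b s \<Longrightarrow> exec d leq (While b c) s (1 + bcost b s) 0 s"
| WhileTrue: "bval b s \<Longrightarrow> exec d leq c s t1 q1 s1 \<Longrightarrow> exec d leq (While b c) s1 t2 q2 s2 \<Longrightarrow>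
     exec d leq (While b c) s (1 + bcost b s + t1 + t2) (q1 + q2) s2"
| Query: "exec d leq (Query x a b) s
     (1 + (\<Sum>k=1..d. bits (s a (int k)) + bits (s b (int k)))) 1
     (s(x := (s x)(0 := (if leq (\<lambda>k. s a (int k)) (\<lambda>k. s b (int k)) then 1 else 0))))"

lemma exec_deterministic:
  "exec d leq c s t q s' \<Longrightarrow> exec d leq c s t2 q2 s2 \<Longrightarrow> t2 = t \<and> q2 = q \<and> s2 = s'"
proof (induction arbitrary: t2 q2 s2 rule: exec.induct)
  case (WhileTrue b s c t1 q1 s1 t2' q2' s2')
  from WhileTrue.prems WhileTrue.hyps(1) show ?case
    by (cases rule: exec.cases) (use WhileTrue.IH in blast)+
next
  case (Seq c1 s ta qa sa c2 tb qb sb)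
  from Seq.prems show ?case by (cases rule: exec.cases) (use Seq.IH in blast)+
qed (erule exec.cases; fastforce)+

text \<open>Polynomial functions in three variables; for upper bounds, nonnegative coefficients suffice.\<close>

definition polynomial3 :: "(nat \<Rightarrow> nat \<Rightarrow> nat \<Rightarrow> nat) \<Rightarrow> bool" where
  "polynomial3 P \<longleftrightarrow> (\<exists>(D :: nat) (c :: nat \<Rightarrow> nat \<Rightarrow> nat \<Rightarrow> nat).
     P = (\<lambda>x y z. \<Sum>a\<le>D. \<Sum>b\<le>D. \<Sum>e\<le>D. c a b e * x ^ a * y ^ b * z ^ e))"


section \<open>Nonlinear bipartite matching\<close>

definition edges :: "nat \<Rightarrow> (nat \<times> nat) set" where
  "edges n = {1..n} \<times> {1..n}"

definition perfect_matching :: "nat \<Rightarrow> (nat \<times> nat) set \<Rightarrow> bool" where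
  "perfect_matching n M \<longleftrightarrow> M \<subseteq> edges n \<and>
     (\<forall>i\<in>{1..n}. \<exists>!j. (i, j) \<in> M) \<and> (\<forall>j\<in>{1..n}. \<exists>!i. (i, j) \<in> M)"

definition weight :: "(nat \<times> nat \<Rightarrow> nat) \<Rightarrow> (nat \<times> nat) set \<Rightarrow> nat" where
  "weight v M = (\<Sum>e\<in>M. v e)"

text \<open>A vector of dimension \<open>d\<close> is a function of which only the values at \<open>1, \<dots>, d\<close> matter.\<close>

definition lp_norm :: "nat \<Rightarrow> ereal \<Rightarrow> (nat \<Rightarrow> real) \<Rightarrow> real" where
  "lp_norm d p y =
     (if p = \<infinity> then Max ((\<lambda>k. \<bar>y k\<bar>) ` {1..d})
      else (\<Sum>k=1..d. \<bar>y k\<bar> powr real_of_ereal p) powr (1 / real_of_ereal p))"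

definition lp_oracle :: "nat \<Rightarrow> ereal \<Rightarrow> (nat \<Rightarrow> int) \<Rightarrow> (nat \<Rightarrow> int) \<Rightarrow> bool" where
  "lp_oracle d p y z \<longleftrightarrow>
     lp_norm d p (\<lambda>k. real_of_int (y k)) \<le> lp_norm d p (\<lambda>k. real_of_int (z k))"

text \<open>Approximative solutions of the problem of maximizing \<open>g\<close> over \<open>S\<close>.\<close>

definition approximative_max :: "real \<Rightarrow> 'a set \<Rightarrow> ('a \<Rightarrow> real) \<Rightarrow> 'a \<Rightarrow> bool" where
  "approximative_max r S g s \<longleftrightarrow> s \<in> S \<and>
     (\<exists>opt. is_arg_max g (\<lambda>x. x \<in> S) opt \<and> 1 / r * g opt \<le> g s \<and> g s \<le> r * g opt)"

text \<open>Zero weights contribute nothing to the maximum, because \<open>log 2 0 = 0\<close> in HOL.\<close>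

definition weight_size :: "nat \<Rightarrow> nat \<Rightarrow> (nat \<Rightarrow> nat \<times> nat \<Rightarrow> nat) \<Rightarrow> nat" where
  "weight_size d n w = Max {nat \<lceil>log 2 (real (w k e))\<rceil> | k e. k \<in> {1..d} \<and> e \<in> edges n}"

text \<open>
  The input: \<open>d\<close> and \<open>n\<close> are stored in variables of these names, the weights in row-major order in
  an array \<open>w\<close>, and all other memory cells are 0.
\<close>

definition input_state :: "nat \<Rightarrow> nat \<Rightarrow> (nat \<Rightarrow> nat \<times> nat \<Rightarrow> nat) \<Rightarrow> state" where
  "input_state d n w = (\<lambda>x a.
     if x = ''d'' \<and> a = 0 then int d
     else if x = ''n'' \<and> a = 0 then int n
     else if x = ''w'' \<and> 0 \<le> a \<and> a < int (d * n * n) then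
       (let m = nat a in int (w (m div (n * n) + 1) (m div n mod n + 1, m mod n + 1)))
     else 0)"

lemma input_state_weights:
  assumes "k < d" "i < n" "j < n"
  shows "input_state d n w ''w'' (int ((k * n + i) * n + j)) = int (w (k + 1) (i + 1, j + 1))"
proof -
  let ?m = "(k * n + i) * n + j"
  have 1: "?m div n = k * n + i" "?m mod n = j"
    using assms by auto
  have 2: "?m div (n * n) = k"
    using assms 1 by (simp add: div_mult2_eq)
  have "k * n + i < d * n"
    using assms by (metis div_less_iff_less_mult add_0_right div_less div_mult_self3 gr_implies_not0 gr0I)
  then have "?m < d * n * n"
    using assms 1 by (metis div_less_iff_less_mult gr_implies_not0 gr0I)
  then show ?thesis
    using assms 1 2 unfolding input_state_def Let_def by (simp del: of_nat_add of_nat_mult)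
qed

text \<open>The output: an array \<open>m\<close> that stores at index \<open>i\<close> the partner of the vertex \<open>i\<close>.\<close>

definition output_matching :: "nat \<Rightarrow> state \<Rightarrow> (nat \<times> nat) set" where
  "output_matching n s = {(i, j). i \<in> {1..n} \<and> s ''m'' (int i) = int j}"

end

theory Submission
  imports Defs
begin

text \<open>
  For a fixed \<open>k\<close>, a perfect matching \<open>M\<^sub>k\<close> of maximal weight \<open>w\<^sup>k(M\<^sub>k)\<close> is the solution of a linear
  assignment problem. Among \<open>M\<^sub>1, \<dots>, M\<^sub>d\<close> the algorithm returns the one with the largest value
  \<open>w\<^sup>k(M\<^sub>k)\<close>; call this value \<open>c\<close>. Then \<open>c\<close> bounds every component of the weight vector of every
  perfect matching, so the optimum is at most \<open>d\<^sup>1\<^sup>/\<^sup>p c\<close>, while the returned matching has \<open>c\<close> as one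
  of its components and hence norm at least \<open>c\<close> (\<open>approximative_max_best_component\<close>).

  The assignment problems are solved by the Hungarian method. It keeps dual prices \<open>u\<close> on rows and
  \<open>v\<close> on columns with \<open>W i j \<le> u i + v j\<close> and a partial assignment that uses only edges where
  equality holds. One row is inserted per phase: an alternating tree of tight edges grows from it, the
  prices being shifted by the minimal slack whenever a new column is reached
  (\<open>tree_extend\<close>), until a free column is found and the assignment is flipped along the tree path
  (\<open>hole_step\<close>). A complete tight assignment is optimal by linear programming duality
  (\<open>tight_assignment_optimal\<close>).

  The running time is derived from the program text. Correctness is shown in a calculus of
  weakest preconditions in which no loop may run more than \<open>N\<close> times whenever it is entered. The
  programs only add and subtract, so one elementary operation lengthens the largest number in memory
  by at most a constant number of bits, and the logarithmic cost is at most quadratic in the number of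
  elementary operations plus the bit length of the input (\<open>wp_imp_exec\<close>). That number of operations
  is a polynomial in \<open>N\<close> for a fixed program (\<open>budget_polynomial\<close>), and \<open>N = d + n + 2\<close> suffices.
\<close>

section \<open>Weakest preconditions with bounded loops\<close>

primrec writes :: "com \<Rightarrow> vname set" where
  "writes Skip = {}"
| "writes (Assign x e a) = {x}"
| "writes (Seq c1 c2) = writes c1 \<union> writes c2"
| "writes (Cond b c1 c2) = writes c1 \<union> writes c2"
| "writes (While b c) = writes c"
| "writes (Query x a b) = {x}"

text \<open>
  The weakest precondition for termination in \<open>Q\<close> when every execution of a loop makes at most
  \<open>N\<close> iterations. The loop is its own \<open>Suc N\<close>-fold unfolding, the additional round being the last
  test of the guard; running out of rounds counts as failure. The calculus covers programs
  without queries.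
\<close>

primrec wp :: "nat \<Rightarrow> com \<Rightarrow> (state \<Rightarrow> bool) \<Rightarrow> state \<Rightarrow> bool" where
  "wp N Skip Q = Q"
| "wp N (Assign x e a) Q = (\<lambda>s. Q (s(x := (s x)(aval e s := aval a s))))"
| "wp N (Seq c1 c2) Q = wp N c1 (wp N c2 Q)"
| "wp N (Cond b c1 c2) Q = (\<lambda>s. if bval b s then wp N c1 Q s else wp N c2 Q s)"
| "wp N (While b c) Q =
     ((\<lambda>R s. if bval b s then wp N c R s else Q s) ^^ Suc N) (\<lambda>_. False)"
| "wp N (Query x a b) Q = (\<lambda>_. False)"

lemma wp_mono:
  "wp N c Q s \<Longrightarrow> (\<And>s'. Q s' \<Longrightarrow> R s') \<Longrightarrow> wp N c R s"
proof (induction c arbitrary: Q R s)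
  case (While b c)
  have "((\<lambda>X s. if bval b s then wp N c X s else Q s) ^^ j) (\<lambda>_. False) s \<Longrightarrow>
        ((\<lambda>X s. if bval b s then wp N c X s else R s) ^^ j) (\<lambda>_. False) s" for j s
  proof (induction j arbitrary: s)
    case (Suc j)
    show ?case
    proof (cases "bval b s")
      case True
      then have "wp N c (((\<lambda>X s. if bval b s then wp N c X s else Q s) ^^ j) (\<lambda>_. False)) s"
        using Suc.prems by simp
      then have "wp N c (((\<lambda>X s. if bval b s then wp N c X s else R s) ^^ j) (\<lambda>_. False)) s"
        by (rule While.IH) (rule Suc.IH)
      then show ?thesis using True by simp
    qed (use Suc.prems While.prems(2) in simp)
  qed simp
  from this[of "Suc N" s] While.prems(1) show ?case by simp
next
  case (Seq c1 c2)
  show ?case unfolding wp.simps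
    by (rule Seq.IH(1)[OF Seq.prems(1)[unfolded wp.simps]]) (rule Seq.IH(2)[OF _ Seq.prems(2)])
qed (auto split: if_splits)

text \<open>
  The variant serves twice: its descent gives termination, its initial value bounds the
  iterations.
\<close>

lemma wp_While:
  fixes I :: "state \<Rightarrow> bool" and \<mu> :: "state \<Rightarrow> nat"
  assumes "I s" "\<mu> s \<le> N"
    and step: "\<And>s. I s \<Longrightarrow> bval b s \<Longrightarrow> wp N c (\<lambda>s'. I s' \<and> \<mu> s' < \<mu> s) s"
    and "\<And>s. I s \<Longrightarrow> \<not> bval b s \<Longrightarrow> Q s"
  shows "wp N (While b c) Q s"
proof -
  have "I s \<Longrightarrow> \<mu> s < j \<Longrightarrow> ((\<lambda>X s. if bval b s then wp N c X s else Q s) ^^ j) (\<lambda>_. False) s"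
    for j s
  proof (induction j arbitrary: s)
    case (Suc j)
    show ?case
    proof (cases "bval b s")
      case True
      have "wp N c ((((\<lambda>X s. if bval b s then wp N c X s else Q s) ^^ j) (\<lambda>_. False))) s"
        by (rule wp_mono[OF step[OF Suc.prems(1) True]]) (use Suc in auto)
      then show ?thesis using True by simp
    qed (use Suc.prems assms(4) in simp)
  qed simp
  from this[of s "Suc N"] assms(1,2) show ?thesis by simp
qed

text \<open>
  The relation behind the frame rule: arrays that a program never assigns to keep their contents,
  so invariants need to speak only about the arrays that change.
\<close>

definition agree :: "vname set \<Rightarrow> state \<Rightarrow> state \<Rightarrow> bool" where
  "agree V s s' \<longleftrightarrow> (\<forall>x. x \<notin> V \<longrightarrow> s' x = s x)"

lemma wp_frame_aux:
  "wp N c Q s \<Longrightarrow> agree V s0 s \<Longrightarrow> writes c \<subseteq> V \<Longrightarrow> wp N c (\<lambda>s'. Q s' \<and> agree V s0 s') s"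
proof (induction c arbitrary: Q s)
  case (While b c)
  let ?F = "\<lambda>Q X s. if bval b s then wp N c X s else Q s"
  have "(?F Q ^^ j) (\<lambda>_. False) s \<Longrightarrow> agree V s0 s \<Longrightarrow>
        (?F (\<lambda>s'. Q s' \<and> agree V s0 s') ^^ j) (\<lambda>_. False) s" for j s
  proof (induction j arbitrary: s)
    case (Suc j)
    show ?case
    proof (cases "bval b s")
      case True
      then have "wp N c ((?F Q ^^ j) (\<lambda>_. False)) s" using Suc.prems by simp
      then have "wp N c (\<lambda>s'. (?F Q ^^ j) (\<lambda>_. False) s' \<and> agree V s0 s') s"
        using While.IH[of "(?F Q ^^ j) (\<lambda>_. False)" s] Suc.prems(2) While.prems(3) by simp
      then have "wp N c ((?F (\<lambda>s'. Q s' \<and> agree V s0 s') ^^ j) (\<lambda>_. False)) s"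
        by (rule wp_mono) (use Suc.IH in simp)
      then show ?thesis using True by simp
    qed (use Suc.prems in simp)
  qed simp
  from this[of "Suc N" s] While.prems show ?case by simp
next
  case (Seq c1 c2)
  then have "wp N c1 (\<lambda>s'. wp N c2 Q s' \<and> agree V s0 s') s" by simp
  then have "wp N c1 (wp N c2 (\<lambda>s'. Q s' \<and> agree V s0 s')) s"
    by (rule wp_mono) (use Seq in simp)
  then show ?case by simp
next
  case (Cond b c1 c2)
  then show ?case by (cases "bval b s") simp_all
qed (auto simp: agree_def)

lemma wp_frame:
  "wp N c Q s \<Longrightarrow> wp N c (\<lambda>s'. Q s' \<and> agree (writes c) s s') s"
  by (rule wp_frame_aux) (auto simp: agree_def)

text \<open>
  The rule for calling a verified subprogram: its specification mentions only what it computes,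
  and the frame is added at the call.
\<close>

lemma wp_conseq:
  "wp N c Q s \<Longrightarrow> (\<And>s'. Q s' \<Longrightarrow> agree (writes c) s s' \<Longrightarrow> R s') \<Longrightarrow> wp N c R s"
  using wp_frame wp_mono by (metis (mono_tags, lifting))

abbreviation Var :: "vname \<Rightarrow> aexp" where
  "Var x \<equiv> Elem x (Const 0)"

abbreviation Set_var :: "vname \<Rightarrow> aexp \<Rightarrow> com" (infix "::=" 62) where
  "x ::= a \<equiv> Assign x (Const 0) a"

abbreviation Semi :: "com \<Rightarrow> com \<Rightarrow> com" (infixr ";;" 60) where
  "c1 ;; c2 \<equiv> Seq c1 c2"

text \<open>
  A counting loop with both bounds included. The upper bound is a variable, because the loops of
  the algorithm run up to the input variables \<open>n\<close> and \<open>d\<close>.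
\<close>

definition For :: "vname \<Rightarrow> int \<Rightarrow> vname \<Rightarrow> com \<Rightarrow> com" where
  "For x l y c = x ::= Const l ;;
     While (Neg (Less (Var y) (Var x))) (c ;; x ::= Add (Var x) (Const 1))"

lemma writes_For [simp]: "writes (For x l y c) = insert x (writes c)"
  by (auto simp: For_def)

text \<open>
  The invariant takes the value of the counter as a parameter, and the body is verified knowing
  that only the arrays written by the loop differ from the state at its start.
\<close>

lemma wp_For:
  fixes I :: "int \<Rightarrow> state \<Rightarrow> bool"
  assumes vars: "x \<notin> writes c" "y \<notin> writes c" "x \<noteq> y"
    and range: "l \<le> s y 0 + 1" "s y 0 + 1 - l \<le> int N"
    and init: "I l (s(x := (s x)(0 := l)))"
    and step: "\<And>k s'. l \<le> k \<Longrightarrow> k \<le> s y 0 \<Longrightarrow> s' x 0 = k \<Longrightarrow> agree (insert x (writes c)) s s' \<Longrightarrow>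
                 I k s' \<Longrightarrow> wp N c (\<lambda>s''. I (k + 1) (s''(x := (s'' x)(0 := k + 1)))) s'"
    and post: "\<And>s'. agree (insert x (writes c)) s s' \<Longrightarrow> I (s y 0 + 1) s' \<Longrightarrow> Q s'"
  shows "wp N (For x l y c) Q s"
proof -
  let ?V = "insert x (writes c)"
  let ?J = "\<lambda>s'. agree ?V s s' \<and> l \<le> s' x 0 \<and> s' x 0 \<le> s y 0 + 1 \<and> I (s' x 0) s'"
  have "wp N (While (Neg (Less (Var y) (Var x))) (c ;; x ::= Add (Var x) (Const 1))) Q
          (s(x := (s x)(0 := l)))"
  proof (rule wp_While[where I = ?J and \<mu> = "\<lambda>s'. nat (s y 0 + 1 - s' x 0)"])
    show "?J (s(x := (s x)(0 := l)))" using init range by (simp add: agree_def)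
    fix s'
    assume J: "?J s'"
    have y: "s' y 0 = s y 0" using J vars by (simp add: agree_def)
    {
      assume "bval (Neg (Less (Var y) (Var x))) s'"
      then have le: "s' x 0 \<le> s y 0" using y by simp
      have "wp N c (\<lambda>s''. I (s' x 0 + 1) (s''(x := (s'' x)(0 := s' x 0 + 1)))) s'"
        using step J le by blast
      from wp_frame[OF this]
      show "wp N (c ;; x ::= Add (Var x) (Const 1))
              (\<lambda>s''. ?J s'' \<and> nat (s y 0 + 1 - s'' x 0) < nat (s y 0 + 1 - s' x 0)) s'"
        unfolding wp.simps
      proof (rule wp_mono)
        fix s''
        assume *: "I (s' x 0 + 1) (s''(x := (s'' x)(0 := s' x 0 + 1))) \<and> agree (writes c) s' s''"
        then have "s'' x = s' x" using vars by (simp add: agree_def)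
        let ?s = "s''(x := (s'' x)(aval (Const 0) s'' := aval (Add (Var x) (Const 1)) s''))"
        show "?J ?s \<and> nat (s y 0 + 1 - ?s x 0) < nat (s y 0 + 1 - s' x 0)"
          using * J le \<open>s'' x = s' x\<close> by (auto simp: agree_def)
      qed
    next
      assume "\<not> bval (Neg (Less (Var y) (Var x))) s'"
      then have "s' x 0 = s y 0 + 1" using y J by simp
      then show "Q s'" using post J by auto
    }
  qed (use range in simp)
  then show ?thesis by (simp add: For_def del: wp.simps(5))
qed

section \<open>The cost of additive programs\<close>

text \<open>
  This size of an expression plays two roles. It bounds how many bits the value is longer than
  the longest entry of the memory, and, multiplied by the bit length of everything involved, it
  bounds the cost of the evaluation. The summand 4 per operation pays for the at most two bits
  that \<open>bits_le\<close> adds to each of two operands.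
\<close>

primrec asize :: "aexp \<Rightarrow> nat" where
  "asize (Const c) = bits c"
| "asize (Elem x e) = asize e + 4"
| "asize (Add a b) = asize a + asize b + 4"
| "asize (Sub a b) = asize a + asize b + 4"
| "asize (Mul a b) = asize a + asize b + 4"

primrec bsize :: "bexp \<Rightarrow> nat" where
  "bsize (Less a b) = 1 + asize a + asize b"
| "bsize (Neg b) = 1 + bsize b"
| "bsize (Conj b c) = 1 + bsize b + bsize c"

primrec additive_aexp :: "aexp \<Rightarrow> bool" where
  "additive_aexp (Const c) = True"
| "additive_aexp (Elem x e) = additive_aexp e"
| "additive_aexp (Add a b) = (additive_aexp a \<and> additive_aexp b)"
| "additive_aexp (Sub a b) = (additive_aexp a \<and> additive_aexp b)"
| "additive_aexp (Mul a b) = False"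

primrec additive_bexp :: "bexp \<Rightarrow> bool" where
  "additive_bexp (Less a b) = (additive_aexp a \<and> additive_aexp b)"
| "additive_bexp (Neg b) = additive_bexp b"
| "additive_bexp (Conj b c) = (additive_bexp b \<and> additive_bexp c)"

text \<open>
  Without multiplication, a sequence of \<open>m\<close> operations increases bit lengths by \<open>O(m)\<close>; repeated
  squaring would double them each time.
\<close>

primrec additive :: "com \<Rightarrow> bool" where
  "additive Skip = True"
| "additive (Assign x e a) = (additive_aexp e \<and> additive_aexp a)"
| "additive (Seq c1 c2) = (additive c1 \<and> additive c2)"
| "additive (Cond b c1 c2) = (additive_bexp b \<and> additive c1 \<and> additive c2)"
| "additive (While b c) = (additive_bexp b \<and> additive c)"
| "additive (Query x a b) = False"

text \<open>
  A bound for the number of elementary operations when every loop takes at most \<open>N\<close> iterations,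
  the constant sizes of expressions included. For a conditional the sum of both branches is as
  good as the maximum.
\<close>

primrec budget :: "nat \<Rightarrow> com \<Rightarrow> nat" where
  "budget N Skip = 1"
| "budget N (Assign x e a) = 1 + asize e + asize a"
| "budget N (Seq c1 c2) = budget N c1 + budget N c2"
| "budget N (Cond b c1 c2) = 1 + bsize b + (budget N c1 + budget N c2)"
| "budget N (While b c) = Suc N * (1 + bsize b + budget N c)"
| "budget N (Query x a b) = 0"

definition bounded_by :: "nat \<Rightarrow> state \<Rightarrow> bool" where
  "bounded_by b s \<longleftrightarrow> (\<forall>x a. \<bar>s x a\<bar> \<le> 2 ^ b)"

lemma bits_le: "\<bar>z\<bar> \<le> 2 ^ b \<Longrightarrow> bits z \<le> b + 2"
proof -
  assume "\<bar>z\<bar> \<le> 2 ^ b"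
  then have "nat \<bar>z\<bar> < 2 ^ (b + 1)"
    by (simp add: nat_less_iff) (smt (verit) zero_less_power)
  then have "floorlog 2 (nat \<bar>z\<bar>) \<le> b + 1"
    by (intro floorlog_leI) (auto)
  then show ?thesis by (simp add: bits_def)
qed

lemma le_power_bits: "\<bar>z\<bar> \<le> 2 ^ bits z"
proof (cases "z = 0")
  case False
  then have "nat \<bar>z\<bar> < 2 ^ floorlog 2 (nat \<bar>z\<bar>)"
    using floorlog_bounds[of "nat \<bar>z\<bar>" 2] by auto
  then have "\<bar>z\<bar> < 2 ^ floorlog 2 (nat \<bar>z\<bar>)" by (simp add: nat_less_iff)
  then show ?thesis by (simp add: bits_def) 
qed simp

lemma aval_le: "additive_aexp a \<Longrightarrow> bounded_by b s \<Longrightarrow> \<bar>aval a s\<bar> \<le> 2 ^ (b + asize a)"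
proof (induction a)
  case (Const c)
  have "(2::int) ^ bits c \<le> 2 ^ (b + bits c)" by (rule power_increasing) auto
  then show ?case using le_power_bits[of c] unfolding aval.simps asize.simps by linarith
next
  case (Elem x e)
  have "(2::int) ^ b \<le> 2 ^ (b + asize (Elem x e))" by (rule power_increasing) auto
  moreover have "\<bar>s x (aval e s)\<bar> \<le> 2 ^ b" using Elem.prems by (simp add: bounded_by_def)
  ultimately show ?case unfolding aval.simps by linarith
next
  case (Add a1 a2)
  have "(2::int) ^ (b + asize a1) \<le> 2 ^ (b + asize a1 + asize a2)"
       "(2::int) ^ (b + asize a2) \<le> 2 ^ (b + asize a1 + asize a2)"
       by (rule power_increasing, auto)+
  moreover have "(2::int) ^ (b + asize (Add a1 a2)) = 16 * 2 ^ (b + asize a1 + asize a2)"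
    by (simp add: power_add)
  moreover have "\<bar>aval a1 s\<bar> \<le> 2 ^ (b + asize a1)" "\<bar>aval a2 s\<bar> \<le> 2 ^ (b + asize a2)"
    using Add by simp_all
  ultimately show ?case unfolding aval.simps by linarith
next
  case (Sub a1 a2)
  have "(2::int) ^ (b + asize a1) \<le> 2 ^ (b + asize a1 + asize a2)"
       "(2::int) ^ (b + asize a2) \<le> 2 ^ (b + asize a1 + asize a2)"
       by (rule power_increasing, auto)+
  moreover have "(2::int) ^ (b + asize (Sub a1 a2)) = 16 * 2 ^ (b + asize a1 + asize a2)"
    by (simp add: power_add)
  moreover have "\<bar>aval a1 s\<bar> \<le> 2 ^ (b + asize a1)" "\<bar>aval a2 s\<bar> \<le> 2 ^ (b + asize a2)"
    using Sub by simp_all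
  ultimately show ?case unfolding aval.simps by linarith
qed simp

lemma acost_le: "additive_aexp a \<Longrightarrow> bounded_by b s \<Longrightarrow> acost a s \<le> asize a * (b + asize a)"
proof (induction a)
  case (Const c)
  have "1 \<le> bits c" by (simp add: bits_def)
  then show ?case by simp
next
  case (Elem x e)
  have "bits (aval e s) \<le> b + asize e + 2"
    using Elem.prems by (intro bits_le aval_le) auto
  moreover have "bits (s x (aval e s)) \<le> b + 2"
    using Elem.prems by (intro bits_le) (simp add: bounded_by_def)
  ultimately show ?case using Elem by (simp add: algebra_simps)
next
  case (Add a1 a2)
  have "bits (aval a1 s) \<le> b + asize a1 + 2" "bits (aval a2 s) \<le> b + asize a2 + 2"
    using Add.prems by (intro bits_le aval_le; simp)+
  then show ?case using Add by (simp add: algebra_simps)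
next
  case (Sub a1 a2)
  have "bits (aval a1 s) \<le> b + asize a1 + 2" "bits (aval a2 s) \<le> b + asize a2 + 2"
    using Sub.prems by (intro bits_le aval_le; simp)+
  then show ?case using Sub by (simp add: algebra_simps)
qed simp

lemma bcost_le: "additive_bexp e \<Longrightarrow> bounded_by b s \<Longrightarrow> bcost e s \<le> bsize e * (b + bsize e)"
proof (induction e)
  case (Less a1 a2)
  then show ?case using acost_le[of a1 b s] acost_le[of a2 b s] by (simp add: algebra_simps)
qed (auto simp: algebra_simps)

lemma bounded_by_mono: "bounded_by b s \<Longrightarrow> b \<le> b' \<Longrightarrow> bounded_by b' s"
  unfolding bounded_by_def by (meson order_trans power_increasing one_le_numeral)

text \<open>
  The form \<open>m * (b + m)\<close> of the cost bound is stable under sequential composition: the second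
  program starts with numbers of \<open>b + m1\<close> bits.
\<close>

lemma cost_sum_le:
  fixes m1 m2 t1 t2 b :: nat
  assumes "t1 \<le> m1 * (b + m1)" "t2 \<le> m2 * (b + m1 + m2)"
  shows "t1 + t2 \<le> (m1 + m2) * (b + (m1 + m2))"
proof -
  have "(m1 + m2) * (b + (m1 + m2)) = m1 * (b + m1) + m2 * (b + m1 + m2) + m1 * m2"
    by (simp add: algebra_simps)
  with assms show ?thesis by linarith
qed

text \<open>
  The only link between the calculus and the machine. The bit length \<open>b\<close> of the memory is
  generalized in the induction, since every part of a program starts with longer numbers than the
  part before it.
\<close>

lemma wp_imp_exec:
  "additive c \<Longrightarrow> wp N c Q s \<Longrightarrow> bounded_by b s \<Longrightarrow> \<exists>t q s'. exec d leq c s t q s' \<and> Q s' \<and>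
     bounded_by (b + budget N c) s' \<and> t + q \<le> budget N c * (b + budget N c)"
proof (induction c arbitrary: Q s b)
  case Skip
  then show ?case using exec.Skip[of d leq s] by (fastforce intro: bounded_by_mono)
next
  case (Assign x e a)
  let ?m = "budget N (Assign x e a)"
  have "\<bar>aval a s\<bar> \<le> 2 ^ (b + ?m)"
    using aval_le[of a b s] Assign.prems power_increasing[of "b + asize a" "b + ?m" "2::int"]
    by simp
  then have "bounded_by (b + ?m) (s(x := (s x)(aval e s := aval a s)))"
    using bounded_by_mono[OF Assign.prems(3), of "b + ?m"] by (simp add: bounded_by_def)
  moreover have "1 + acost e s + acost a s + 0 \<le> ?m * (b + ?m)"
    using acost_le[of e b s] acost_le[of a b s] Assign.prems by (simp add: algebra_simps)
  ultimately show ?case using exec.Assign[of d leq x e a s] Assign.prems(2) by fastforce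
next
  case (Seq c1 c2)
  let ?m1 = "budget N c1" and ?m2 = "budget N c2"
  obtain t1 q1 s1 where 1: "exec d leq c1 s t1 q1 s1" "wp N c2 Q s1"
    "bounded_by (b + ?m1) s1" "t1 + q1 \<le> ?m1 * (b + ?m1)"
    using Seq.IH(1)[of "wp N c2 Q" s b] Seq.prems by auto
  obtain t2 q2 s2 where 2: "exec d leq c2 s1 t2 q2 s2" "Q s2"
    "bounded_by (b + ?m1 + ?m2) s2" "t2 + q2 \<le> ?m2 * (b + ?m1 + ?m2)"
    using Seq.IH(2)[OF _ 1(2,3)] Seq.prems by auto
  show ?case
    using exec.Seq[OF 1(1) 2(1)] 2(2,3) cost_sum_le[OF 1(4) 2(4)]
    by (intro exI[of _ "t1 + t2"] exI[of _ "q1 + q2"] exI[of _ s2]) (simp add: add_ac)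
next
  case (Cond e c1 c2)
  let ?m = "budget N (Cond e c1 c2)" 
  have e: "1 + bcost e s \<le> (1 + bsize e) * (b + (1 + bsize e))"
    using bcost_le[of e b s] Cond.prems by (simp add: algebra_simps)
  have *: "1 + bcost e s + t + q \<le> ?m * (b + ?m)"
    if "t + q \<le> k * (b + k)" "k \<le> budget N c1 + budget N c2" for t q k
  proof -
    have "k * (b + k) \<le> (budget N c1 + budget N c2) * (b + (budget N c1 + budget N c2))"
      using that(2) by (intro mult_mono) auto
    with that e show ?thesis by (simp add: algebra_simps)
  qed
  show ?case
  proof (cases "bval e s")
    case True
    obtain t q s' where "exec d leq c1 s t q s'" "Q s'"
      "bounded_by (b + budget N c1) s'" "t + q \<le> budget N c1 * (b + budget N c1)"
      using Cond.IH(1)[of Q s b] Cond.prems True by auto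
    then show ?thesis
      using exec.CondTrue[OF True, of d leq c1 t q s' c2] *[of t q "budget N c1"]
        bounded_by_mono[of "b + budget N c1" s' "b + ?m"]
      by (intro exI[of _ "1 + bcost e s + t"] exI[of _ q] exI[of _ s']) simp
  next
    case False
    obtain t q s' where "exec d leq c2 s t q s'" "Q s'"
      "bounded_by (b + budget N c2) s'" "t + q \<le> budget N c2 * (b + budget N c2)"
      using Cond.IH(2)[of Q s b] Cond.prems False by auto
    then show ?thesis
      using exec.CondFalse[OF False, of d leq c2 t q s' c1] *[of t q "budget N c2"]
        bounded_by_mono[of "b + budget N c2" s' "b + ?m"]
      by (intro exI[of _ "1 + bcost e s + t"] exI[of _ q] exI[of _ s']) simp
  qed
next
  case (While e c)
  let ?F = "\<lambda>X s. if bval e s then wp N c X s else Q s"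
  let ?k = "1 + bsize e" and ?l = "budget N c"
  have "(?F ^^ j) (\<lambda>_. False) s \<Longrightarrow> bounded_by b s \<Longrightarrow>
    \<exists>t q s'. exec d leq (While e c) s t q s' \<and> Q s' \<and>
     bounded_by (b + j * (?k + ?l)) s' \<and> t + q \<le> j * (?k + ?l) * (b + j * (?k + ?l))" for j s b
  proof (induction j arbitrary: s b)
    case (Suc j)
    let ?r = "j * (?k + ?l)"
    have e: "1 + bcost e s \<le> ?k * (b + ?k)"
      using bcost_le[of e b s] While.prems(1) Suc.prems(2) by (simp add: algebra_simps)
    show ?case
    proof (cases "bval e s")
      case True
      obtain t1 q1 s1 where 1: "exec d leq c s t1 q1 s1" "(?F ^^ j) (\<lambda>_. False) s1"
        "bounded_by (b + ?l) s1" "t1 + q1 \<le> ?l * (b + ?l)"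
        using While.IH[of "(?F ^^ j) (\<lambda>_. False)" s b] While.prems(1) Suc.prems True by auto
      obtain t2 q2 s2 where 2: "exec d leq (While e c) s1 t2 q2 s2" "Q s2"
        "bounded_by (b + ?l + ?r) s2" "t2 + q2 \<le> ?r * (b + ?l + ?r)"
        using Suc.IH[OF 1(2,3)] by auto
      have r: "Suc j * (?k + ?l) = ?k + (?l + ?r)" by simp
      have "(1 + bcost e s + t1 + t2) + (q1 + q2) \<le> Suc j * (?k + ?l) * (b + Suc j * (?k + ?l))"
        using cost_sum_le[OF 1(4) 2(4)] e unfolding r by (simp add: algebra_simps)
      moreover have "bounded_by (b + Suc j * (?k + ?l)) s2"
        using bounded_by_mono[OF 2(3)] by simp
      ultimately show ?thesis
        using exec.WhileTrue[OF True 1(1) 2(1)] 2(2) by blast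
    next
      case False
      have "1 + bcost e s + 0 \<le> Suc j * (?k + ?l) * (b + Suc j * (?k + ?l))"
      proof -
        have "?k * (b + ?k) \<le> Suc j * (?k + ?l) * (b + Suc j * (?k + ?l))"
          by (intro mult_mono) auto
        with e show ?thesis by linarith
      qed
      moreover have "Q s" using Suc.prems(1) False by simp
      moreover have "bounded_by (b + Suc j * (?k + ?l)) s"
        by (rule bounded_by_mono[OF Suc.prems(2)]) simp
      ultimately show ?thesis
        using exec.WhileFalse[OF False, of d leq c] by blast
    qed
  qed simp
  from this[of "Suc N" s b] While.prems show ?case by simp
qed simp

text \<open>
  Each loop multiplies the bound by \<open>Suc N\<close>. For a sequence or a conditional the degrees are
  added; their maximum would do as well.
\<close>

lemma budget_polynomial: "\<exists>K D. \<forall>N. budget N c \<le> K * Suc N ^ D"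
proof (induction c)
  case (Seq c1 c2)
  obtain K1 D1 where *: "\<And>N. budget N c1 \<le> K1 * Suc N ^ D1" using Seq.IH(1) by blast
  obtain K2 D2 where **: "\<And>N. budget N c2 \<le> K2 * Suc N ^ D2" using Seq.IH(2) by blast
  have "budget N (Seq c1 c2) \<le> (K1 + K2) * Suc N ^ (D1 + D2)" for N
  proof -
    have "K1 * Suc N ^ D1 \<le> K1 * Suc N ^ (D1 + D2)" "K2 * Suc N ^ D2 \<le> K2 * Suc N ^ (D1 + D2)"
      by (intro mult_left_mono power_increasing; simp)+
    then show ?thesis using *[of N] **[of N] unfolding budget.simps add_mult_distrib by linarith
  qed
  then show ?case by blast
next
  case (Cond b c1 c2)
  obtain K1 D1 where *: "\<And>N. budget N c1 \<le> K1 * Suc N ^ D1" using Cond.IH(1) by blast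
  obtain K2 D2 where **: "\<And>N. budget N c2 \<le> K2 * Suc N ^ D2" using Cond.IH(2) by blast
  have "budget N (Cond b c1 c2) \<le> (1 + bsize b + K1 + K2) * Suc N ^ (D1 + D2)" for N
  proof -
    have "K1 * Suc N ^ D1 \<le> K1 * Suc N ^ (D1 + D2)" "K2 * Suc N ^ D2 \<le> K2 * Suc N ^ (D1 + D2)"
      "(1 + bsize b) * 1 \<le> (1 + bsize b) * Suc N ^ (D1 + D2)"
      by (intro mult_left_mono power_increasing; simp)+
    then show ?thesis using *[of N] **[of N] unfolding budget.simps add_mult_distrib by linarith
  qed
  then show ?case by blast
next
  case (While b c)
  obtain K D where *: "\<And>N. budget N c \<le> K * Suc N ^ D" using While.IH by blast
  have "budget N (While b c) \<le> (1 + bsize b + K) * Suc N ^ Suc D" for N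
  proof -
    have "(1 + bsize b) * 1 \<le> (1 + bsize b) * Suc N ^ D"
      by (intro mult_left_mono; simp)
    then have "1 + bsize b + budget N c \<le> (1 + bsize b + K) * Suc N ^ D"
      using *[of N] unfolding add_mult_distrib by linarith
    then have "Suc N * (1 + bsize b + budget N c) \<le> Suc N * ((1 + bsize b + K) * Suc N ^ D)"
      by (rule mult_left_mono) simp
    also have "\<dots> = (1 + bsize b + K) * Suc N ^ Suc D" by (simp only: power_Suc mult_ac)
    finally show ?thesis by simp
  qed
  then show ?case by blast
next
  case (Assign x e a)
  show ?case by (rule exI[of _ "1 + asize e + asize a"], rule exI[of _ 0]) simp
next
  case Skip
  show ?case by (rule exI[of _ 1], rule exI[of _ 0]) simp
qed simp

section \<open>Duality and alternating trees for the assignment problem\<close>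

text \<open>
  Rows and columns are numbered from 1 to \<open>n\<close>; \<open>u i\<close> and \<open>v j\<close> are the dual variables of row \<open>i\<close>
  and column \<open>j\<close> in the linear program of the assignment problem.
\<close>

definition feasible :: "int \<Rightarrow> (int \<Rightarrow> int \<Rightarrow> int) \<Rightarrow> (int \<Rightarrow> int) \<Rightarrow> (int \<Rightarrow> int) \<Rightarrow> bool" where
  "feasible n W u v \<longleftrightarrow> (\<forall>i\<in>{1..n}. \<forall>j\<in>{1..n}. W i j \<le> u i + v j)"

text \<open>
  A partial assignment is stored by columns: \<open>p j\<close> is the row matched with column \<open>j\<close>, or 0 if
  the column is free. The rows \<open>1, \<dots>, r\<close> are those inserted so far. The set \<open>X\<close> of columns varies
  because during a phase the new row is parked at the dummy column 0.
\<close>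

definition assigns :: "int set \<Rightarrow> (int \<Rightarrow> int) \<Rightarrow> int \<Rightarrow> bool" where
  "assigns X p r \<longleftrightarrow> bij_betw p {j\<in>X. p j \<noteq> 0} {1..r}"

definition tight_on :: "int set \<Rightarrow> (int \<Rightarrow> int \<Rightarrow> int) \<Rightarrow> (int \<Rightarrow> int) \<Rightarrow> (int \<Rightarrow> int) \<Rightarrow> (int \<Rightarrow> int) \<Rightarrow> bool" where
  "tight_on X W u v p \<longleftrightarrow> (\<forall>j\<in>X. p j \<noteq> 0 \<longrightarrow> u (p j) + v j = W (p j) j)"

text \<open>
  Column \<open>j\<close> was reached through a tight edge from the row matched with column \<open>way j\<close>. The
  stamps number the columns of the tree in the order in which they are reached, 0 meaning not
  reached; since they decrease along \<open>way\<close>, following \<open>way\<close> ends at the root.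
\<close>

definition tree_edge where
  "tree_edge n W u v p way stamp j \<longleftrightarrow> way j \<in> {0..n} \<and> 0 < stamp (way j) \<and> stamp (way j) < stamp j \<and>
     p (way j) \<noteq> 0 \<and> u (p (way j)) + v j = W (p (way j)) j"
  for n :: int and W :: "int \<Rightarrow> int \<Rightarrow> int" and u v p way stamp :: "int \<Rightarrow> int"

text \<open>
  The state of the search for an augmenting path. The root is the dummy column 0, which holds the
  new row \<open>r\<close>; \<open>c\<close> is the column reached last, the only one in the tree that may be free. The
  cardinality bound on \<open>stamp c\<close> limits the number of growing steps.
\<close>

definition alternating_tree where
  "alternating_tree n W r u v p way stamp c \<longleftrightarrow>
     1 \<le> r \<and> r \<le> n \<and> feasible n W u v \<and> tight_on {1..n} W u v p \<and> assigns {0..n} p r \<and> p 0 = r \<and>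
     c \<in> {0..n} \<and> 0 < stamp 0 \<and> 0 < stamp c \<and>
     (\<forall>j\<in>{0..n}. 0 \<le> stamp j \<and> stamp j \<le> stamp c) \<and>
     stamp c \<le> int (card {j\<in>{0..n}. 0 < stamp j}) \<and>
     (\<forall>j\<in>{0..n}. 0 < stamp j \<longrightarrow> j \<noteq> c \<longrightarrow> p j \<noteq> 0) \<and>
     (\<forall>j\<in>{1..n}. 0 < stamp j \<longrightarrow> tree_edge n W u v p way stamp j)"
  for n :: int and W :: "int \<Rightarrow> int \<Rightarrow> int" and r c :: int and u v p way stamp :: "int \<Rightarrow> int"

text \<open>
  The state while the assignment is being flipped: column \<open>c\<close> awaits a new row and its entry in
  \<open>p\<close> is out of date, whereas the columns other than \<open>c\<close> hold all the rows. Only the part of the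
  tree with stamps up to that of \<open>c\<close> is still intact; the path from \<open>c\<close> to the root lies in it.
\<close>

definition hole where
  "hole n W r u v p way stamp c \<longleftrightarrow>
     c \<in> {0..n} \<and> feasible n W u v \<and> tight_on ({1..n} - {c}) W u v p \<and> assigns ({0..n} - {c}) p r \<and>
     0 < stamp c \<and>
     (\<forall>j\<in>{1..n}. 0 < stamp j \<longrightarrow> stamp j \<le> stamp c \<longrightarrow> tree_edge n W u v p way stamp j)"
  for n :: int and W :: "int \<Rightarrow> int \<Rightarrow> int" and r c :: int and u v p way stamp :: "int \<Rightarrow> int"

lemma assigns_mem: "assigns X p r \<Longrightarrow> j \<in> X \<Longrightarrow> p j \<noteq> 0 \<Longrightarrow> p j \<in> {1..r}"
  unfolding assigns_def bij_betw_def by blast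

lemma assigns_inj: "assigns X p r \<Longrightarrow> i \<in> X \<Longrightarrow> j \<in> X \<Longrightarrow> p i = p j \<Longrightarrow> p i \<noteq> 0 \<Longrightarrow> i = j"
  unfolding assigns_def bij_betw_def by (auto dest: inj_onD)

lemma assigns_fresh:
  assumes "assigns {1..n} p (r - 1)" "1 \<le> r" "0 \<le> n"
  shows "assigns {0..n} (p(0 := r)) r"
proof -
  let ?p = "p(0 := r)"
  have 1: "{j\<in>{0..n}. ?p j \<noteq> 0} = insert 0 {j\<in>{1..n}. p j \<noteq> 0}"
    using assms by (auto simp: le_less)
  have "bij_betw ?p {j\<in>{1..n}. p j \<noteq> 0} {1..r-1}"
    using assms(1) unfolding assigns_def by (rule bij_betw_cong[THEN iffD1, rotated]) auto
  moreover have "bij_betw ?p {0} {r}" by (simp add: bij_betw_def)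
  ultimately have "bij_betw ?p ({j\<in>{1..n}. p j \<noteq> 0} \<union> {0}) ({1..r-1} \<union> {r})"
    by (rule bij_betw_combine) auto
  moreover have "{1..r-1} \<union> {r} = {1..r}" using assms by auto
  ultimately show ?thesis unfolding assigns_def 1 by simp
qed

lemma tree_start:
  assumes "feasible n W u v" "tight_on {1..n} W u v p" "assigns {1..n} p (r - 1)" "1 \<le> r" "r \<le> n"
    and "\<And>j. j \<in> {1..n} \<Longrightarrow> stamp j = 0" "stamp 0 = 1"
  shows "alternating_tree n W r u v (p(0 := r)) way stamp 0"
proof -
  have s: "stamp j = 0 \<or> j = 0" if "j \<in> {0..n}" for j
    using that assms(6)[of j] by (cases "j = 0") auto
  then have "{j\<in>{0..n}. 0 < stamp j} = {0}" using assms by force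
  then have "stamp 0 \<le> int (card {j\<in>{0..n}. 0 < stamp j})" using assms by simp
  moreover have "\<forall>j\<in>{0..n}. 0 \<le> stamp j \<and> stamp j \<le> stamp 0"
    using s assms(7) by force
  moreover have "tight_on {1..n} W u v (p(0 := r))"
    using assms(2) by (simp add: tight_on_def)
  ultimately show ?thesis
    using assms assigns_fresh[OF assms(3,4)] s by (fastforce simp: alternating_tree_def)
qed

text \<open>
  If all columns were in the tree, all \<open>n + 1\<close> of them, dummy included, would be matched with the
  at most \<open>n\<close> rows inserted so far.
\<close>

lemma tree_unreached:
  assumes t: "alternating_tree n W r u v p way stamp c" and c: "p c \<noteq> 0"
  shows "\<exists>j\<in>{1..n}. stamp j = 0"
proof (rule ccontr)
  assume "\<not> ?thesis"
  then have "\<forall>j\<in>{0..n}. 0 < stamp j"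
    using t unfolding alternating_tree_def by (smt (verit) atLeastAtMost_iff)
  then have "{j\<in>{0..n}. p j \<noteq> 0} = {0..n}"
    using t c unfolding alternating_tree_def by blast
  then have "bij_betw p {0..n} {1..r}" using t by (simp add: alternating_tree_def assigns_def)
  from bij_betw_same_card[OF this] have "nat (n + 1) = nat r" by simp
  moreover have "1 \<le> r" "r \<le> n" using t by (simp_all add: alternating_tree_def)
  ultimately show False by linarith
qed

lemma tree_stamp_le:
  assumes t: "alternating_tree n W r u v p way stamp c"
  shows "stamp c \<le> n + 1"
proof -
  have "card {j\<in>{0..n}. 0 < stamp j} \<le> card {0..n}" by (rule card_mono) auto
  then have "card {j\<in>{0..n}. 0 < stamp j} \<le> nat (n + 1)" by simp
  moreover have "stamp c \<le> int (card {j\<in>{0..n}. 0 < stamp j})" "1 \<le> r" "r \<le> n"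
    using t by (simp_all add: alternating_tree_def)
  ultimately show ?thesis by linarith
qed

text \<open>
  With \<open>raise_columns\<close>, the dual step of the Hungarian method for a tree with the set \<open>X\<close> of
  columns. The two changes cancel on the edges inside the tree.
\<close>

definition lower_rows where
  "lower_rows X p \<delta> u = (\<lambda>i. if i \<in> p ` X then u i - \<delta> else u i)"
  for X :: "int set" and p u :: "int \<Rightarrow> int" and \<delta> :: int

definition raise_columns where
  "raise_columns X \<delta> v = (\<lambda>j. if j \<in> X then v j + \<delta> else v j)"
  for X :: "int set" and v :: "int \<Rightarrow> int" and \<delta> :: int

abbreviation reached :: "int \<Rightarrow> (int \<Rightarrow> int) \<Rightarrow> int set" where
  "reached n stamp \<equiv> {j\<in>{0..n}. 0 < stamp j}"

text \<open>
  Shifting the prices of the tree by \<open>\<delta>\<close> leaves \<open>u i + v j\<close> as it is if both or neither of row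
  and column are in the tree, increases it if only the column is, and decreases it by \<open>\<delta>\<close> if only
  the row is. In the last case the minimality of \<open>\<delta>\<close> preserves feasibility, and the edge
  attaining the minimum becomes tight and can join the tree. A matched edge has both ends in the
  tree or none, so it stays tight.
\<close>

lemma tree_extend:
  assumes t: "alternating_tree n W r u v p way stamp c" and c: "p c \<noteq> 0"
    and src: "x0 \<in> {0..n}" "0 < stamp x0" and dst: "y0 \<in> {1..n}" "stamp y0 = 0"
    and \<delta>: "\<delta> = u (p x0) + v y0 - W (p x0) y0"
    and min: "\<And>x y. x \<in> {0..n} \<Longrightarrow> 0 < stamp x \<Longrightarrow> y \<in> {1..n} \<Longrightarrow> stamp y = 0 \<Longrightarrow>
                \<delta> \<le> u (p x) + v y - W (p x) y"
  shows "alternating_tree n W r (lower_rows (reached n stamp) p \<delta> u) (raise_columns (reached n stamp) \<delta> v)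
           p (way(y0 := x0)) (stamp(y0 := stamp c + 1)) y0"
proof -
  let ?T = "reached n stamp"
  let ?u = "lower_rows ?T p \<delta> u" and ?v = "raise_columns ?T \<delta> v"
  let ?way = "way(y0 := x0)" and ?stamp = "stamp(y0 := stamp c + 1)"
  have r: "1 \<le> r" "r \<le> n" and feas: "feasible n W u v" and tight: "tight_on {1..n} W u v p"
    and asg: "assigns {0..n} p r" and p0: "p 0 = r" and c_in: "c \<in> {0..n}"
    and s0: "0 < stamp 0" and sc: "0 < stamp c"
    and sle: "\<And>j. j \<in> {0..n} \<Longrightarrow> 0 \<le> stamp j \<and> stamp j \<le> stamp c"
    and scard: "stamp c \<le> int (card ?T)"
    and mate: "\<And>j. j \<in> {0..n} \<Longrightarrow> 0 < stamp j \<Longrightarrow> p j \<noteq> 0"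
    and edge: "\<And>j. j \<in> {1..n} \<Longrightarrow> 0 < stamp j \<Longrightarrow> tree_edge n W u v p way stamp j"
    using t c unfolding alternating_tree_def by blast+
  have row: "p x \<in> {1..n}" if "x \<in> ?T" for x
    using assigns_mem[OF asg, of x] mate that r by auto
  have "0 \<le> \<delta>"
    using feas row[of x0] src dst unfolding feasible_def \<delta> by force
  have in_rows: "p x \<in> p ` ?T \<longleftrightarrow> x \<in> ?T" if "x \<in> {0..n}" "p x \<noteq> 0" for x
    using assigns_inj[OF asg that(1)] that by auto
  have "feasible n W ?u ?v"
    unfolding feasible_def
  proof (intro ballI)
    fix i j assume ij: "i \<in> {1..n}" "j \<in> {1..n}"
    then have ge: "W i j \<le> u i + v j" using feas by (simp add: feasible_def)
    show "W i j \<le> ?u i + ?v j"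
    proof (cases "i \<in> p ` ?T \<and> j \<notin> ?T")
      case True
      then obtain x where x: "x \<in> ?T" "i = p x" by auto
      have "stamp j = 0" using True ij sle[of j] by force
      with min[of x j] x ij have "\<delta> \<le> u i + v j - W i j" by simp
      then show ?thesis using True by (auto simp: lower_rows_def raise_columns_def)
    qed (use ge \<open>0 \<le> \<delta>\<close> in \<open>auto simp: lower_rows_def raise_columns_def\<close>)
  qed
  moreover have "tight_on {1..n} W ?u ?v p"
    using tight in_rows by (force simp: tight_on_def lower_rows_def raise_columns_def)
  moreover have "tree_edge n W ?u ?v p ?way ?stamp j" if j: "j \<in> {1..n}" "0 < ?stamp j" for j
  proof (cases "j = y0")
    case True
    have "x0 \<noteq> y0" using src dst by auto
    then show ?thesis
      using True src dst mate[of x0] sle[of x0] \<delta>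
      by (auto simp: tree_edge_def lower_rows_def raise_columns_def)
  next
    case False
    then have "0 < stamp j" using j by simp
    from edge[OF j(1) this] have e: "tree_edge n W u v p way stamp j" .
    then have "way j \<noteq> y0" using dst by (auto simp: tree_edge_def)
    with e False j \<open>0 < stamp j\<close> show ?thesis
      by (auto simp: tree_edge_def lower_rows_def raise_columns_def)
  qed
  moreover have "?stamp y0 \<le> int (card (reached n ?stamp))"
  proof -
    have "reached n ?stamp = insert y0 ?T" using dst sc by auto
    moreover have "y0 \<notin> ?T" using dst by simp
    moreover have "finite ?T" by (rule finite_subset[of _ "{0..n}"]) auto
    ultimately show ?thesis using scard by simp
  qed
  moreover have "\<forall>j\<in>{0..n}. 0 \<le> ?stamp j \<and> ?stamp j \<le> ?stamp y0"
    using sle sc by force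
  ultimately show ?thesis
    using r asg p0 s0 sc dst mate unfolding alternating_tree_def by auto
qed

lemma hole_start:
  assumes t: "alternating_tree n W r u v p way stamp c" and c: "p c = 0"
  shows "hole n W r u v p way stamp c"
proof -
  have "{j\<in>{0..n} - {c}. p j \<noteq> 0} = {j\<in>{0..n}. p j \<noteq> 0}" using c by auto
  then show ?thesis using t by (auto simp: alternating_tree_def hole_def assigns_def tight_on_def)
qed

text \<open>
  Column \<open>c\<close> takes over the row of its predecessor \<open>way c\<close>, which becomes the new hole. The rows
  held by the columns other than the hole are the same before and after.
\<close>

lemma hole_step:
  assumes h: "hole n W r u v p way stamp c" and c: "c \<noteq> 0"
  shows "hole n W r u v (p(c := p (way c))) way stamp (way c)" "stamp (way c) < stamp c"
proof -
  have c_in: "c \<in> {1..n}" and sc: "0 < stamp c" and feas: "feasible n W u v"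
    and tight: "tight_on ({1..n} - {c}) W u v p" and asg: "assigns ({0..n} - {c}) p r"
    and edges: "\<And>j. j \<in> {1..n} \<Longrightarrow> 0 < stamp j \<Longrightarrow> stamp j \<le> stamp c \<Longrightarrow> tree_edge n W u v p way stamp j"
    using h c unfolding hole_def by auto
  from edges[OF c_in sc] have e: "way c \<in> {0..n}" "0 < stamp (way c)" "stamp (way c) < stamp c"
    "p (way c) \<noteq> 0" "u (p (way c)) + v c = W (p (way c)) c"
    by (auto simp: tree_edge_def)
  show "stamp (way c) < stamp c" by (rule e)
  let ?p = "p(c := p (way c))"
  have ne: "way c \<noteq> c" using e by auto
  have "tight_on ({1..n} - {way c}) W u v ?p"
    using tight e ne by (auto simp: tight_on_def)
  moreover have "assigns ({0..n} - {way c}) ?p r"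
  proof -
    \<comment> \<open>The new assignment is the old one after renaming column \<open>c\<close> to \<open>way c\<close>.\<close>
    let ?\<tau> = "\<lambda>j. if j = c then way c else j"
    have dom: "bij_betw ?\<tau> {j\<in>{0..n} - {way c}. ?p j \<noteq> 0} {j\<in>{0..n} - {c}. p j \<noteq> 0}"
      by (rule bij_betw_byWitness[where f' = "\<lambda>j. if j = way c then c else j"])
        (use e ne c_in in \<open>auto split: if_splits\<close>)
    have "bij_betw (p \<circ> ?\<tau>) {j\<in>{0..n} - {way c}. ?p j \<noteq> 0} {1..r}"
      using bij_betw_trans[OF dom asg[unfolded assigns_def]] .
    moreover have "p \<circ> ?\<tau> = ?p" by auto
    ultimately show ?thesis unfolding assigns_def by simp
  qed
  moreover have "tree_edge n W u v ?p way stamp j"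
    if j: "j \<in> {1..n}" "0 < stamp j" "stamp j \<le> stamp (way c)" for j
  proof -
    have ed: "tree_edge n W u v p way stamp j" using edges j e by simp
    then have "stamp (way j) < stamp c" using j e by (simp add: tree_edge_def)
    then have "way j \<noteq> c" by auto
    with ed show ?thesis by (simp add: tree_edge_def)
  qed
  ultimately show "hole n W r u v ?p way stamp (way c)"
    using feas e unfolding hole_def by blast
qed

text \<open>
  The hole has reached the dummy column: the new row has been given away, and every row is
  matched with a proper column.
\<close>

lemma hole_end:
  assumes "hole n W r u v p way stamp 0"
  shows "feasible n W u v" "tight_on {1..n} W u v p" "assigns {1..n} p r"
proof -
  have "{0..n} - {0} = {1..n}" "{1..n} - {0} = {1..n}" by auto
  then show "feasible n W u v" "tight_on {1..n} W u v p" "assigns {1..n} p r"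
    using assms by (simp_all add: hole_def)
qed

lemma assigns_all:
  assumes "assigns {1..n} p n"
  shows "bij_betw p {1..n} {1..n}"
proof -
  have "card {j\<in>{1..n}. p j \<noteq> 0} = card {1..n}"
    using bij_betw_same_card assms unfolding assigns_def by blast
  then have "{j\<in>{1..n}. p j \<noteq> 0} = {1..n}"
    by (intro card_subset_eq) auto
  then show ?thesis using assms by (simp add: assigns_def)
qed

text \<open>
  Weak duality: the sum of all prices is an upper bound for the value of every assignment, and a
  tight assignment attains it.
\<close>

lemma tight_assignment_optimal:
  assumes feas: "feasible n W u v" and tight: "tight_on {1..n} W u v p"
    and p: "bij_betw p {1..n} {1..n}" and q: "bij_betw q {1..n} {1..n}"
  shows "(\<Sum>j=1..n. W (q j) j) \<le> (\<Sum>j=1..n. W (p j) j)"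
proof -
  have "(\<Sum>j=1..n. W (q j) j) \<le> (\<Sum>j=1..n. u (q j) + v j)"
    using feas bij_betw_apply[OF q] by (intro sum_mono) (simp add: feasible_def)
  also have "\<dots> = (\<Sum>j=1..n. u j) + (\<Sum>j=1..n. v j)"
    using sum.reindex_bij_betw[OF q, of u] by (simp add: sum.distrib)
  also have "\<dots> = (\<Sum>j=1..n. u (p j) + v j)"
    using sum.reindex_bij_betw[OF p, of u] by (simp add: sum.distrib)
  also have "\<dots> = (\<Sum>j=1..n. W (p j) j)"
    using tight bij_betw_apply[OF p] by (intro sum.cong) (force simp: tight_on_def)+
  finally show ?thesis .
qed

section \<open>The Hungarian method as a program\<close>

text \<open>
  The weight matrix that the program works on: \<open>base\<close> holds for each row the offset of its
  entries in the input array \<open>w\<close>, so that addresses are computed by additions.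
\<close>

definition edge_weight :: "state \<Rightarrow> int \<Rightarrow> int \<Rightarrow> int" where
  "edge_weight s i j = s ''w'' (s ''base'' i + j)"

lemma edge_weight_upd [simp]:
  "x \<noteq> ''w'' \<Longrightarrow> x \<noteq> ''base'' \<Longrightarrow> edge_weight (s(x := f)) = edge_weight s"
  by (simp add: edge_weight_def fun_eq_iff)

abbreviation slack :: "state \<Rightarrow> int \<Rightarrow> int \<Rightarrow> int" where
  "slack s x y \<equiv> s ''u'' (s ''mate'' x) + s ''v'' y - edge_weight s (s ''mate'' x) y"

text \<open>
  Invariant of a search for the minimum of \<open>f\<close> over the pairs \<open>E\<close> examined so far. The value \<open>-1\<close>
  can mark that there was no candidate yet, since slacks are nonnegative.
\<close>

definition minimizes :: "(int \<times> int) set \<Rightarrow> (int \<Rightarrow> int \<Rightarrow> int) \<Rightarrow> int \<Rightarrow> int \<Rightarrow> int \<Rightarrow> bool" where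
  "minimizes E f \<delta> a b \<longleftrightarrow>
     (if E = {} then \<delta> = -1 else (a, b) \<in> E \<and> \<delta> = f a b \<and> 0 \<le> \<delta> \<and> (\<forall>(x, y)\<in>E. \<delta> \<le> f x y))"

lemma minimizesD:
  assumes "minimizes E f \<delta> a b" "E \<noteq> {}"
  shows "(a, b) \<in> E" "\<delta> = f a b" "\<And>x y. (x, y) \<in> E \<Longrightarrow> \<delta> \<le> f x y"
  using assms by (auto simp: minimizes_def)

lemma minimizes_better:
  "minimizes E f \<delta> a b \<Longrightarrow> 0 \<le> f x y \<Longrightarrow> \<delta> < 0 \<or> f x y < \<delta> \<Longrightarrow> minimizes (insert (x, y) E) f (f x y) x y"
  by (force simp: minimizes_def split: if_splits)

lemma minimizes_keep:
  "minimizes E f \<delta> a b \<Longrightarrow> \<not> (\<delta> < 0 \<or> f x y < \<delta>) \<Longrightarrow> minimizes (insert (x, y) E) f \<delta> a b"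
  by (force simp: minimizes_def split: if_splits)

text \<open>
  The rows of the tree are enumerated through the columns that they are matched with, so that no
  list of rows has to be maintained.
\<close>

definition find_min :: com where
  "find_min =
     ''delta'' ::= Const (-1) ;;
     For ''i'' 0 ''n''
       (Cond (Less (Const 0) (Elem ''stamp'' (Var ''i'')))
         (For ''j'' 1 ''n''
           (Cond (Less (Elem ''stamp'' (Var ''j'')) (Const 1))
             (''slack'' ::= Sub (Add (Elem ''u'' (Elem ''mate'' (Var ''i''))) (Elem ''v'' (Var ''j'')))
                 (Elem ''w'' (Add (Elem ''base'' (Elem ''mate'' (Var ''i''))) (Var ''j''))) ;;
              Cond (Conj (Neg (Less (Var ''delta'') (Const 0))) (Neg (Less (Var ''slack'') (Var ''delta''))))
                Skip
                (''delta'' ::= Var ''slack'' ;; ''src'' ::= Var ''i'' ;; ''dst'' ::= Var ''j''))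
             Skip))
         Skip)"

lemma writes_find_min [simp]:
  "writes find_min = {''delta'', ''i'', ''j'', ''slack'', ''src'', ''dst''}"
  by (auto simp: find_min_def)

lemma wp_find_min:
  fixes s :: state
  defines "E \<equiv> {(x, y). x \<in> reached (s ''n'' 0) (s ''stamp'') \<and> y \<in> {1..s ''n'' 0} \<and> s ''stamp'' y \<le> 0}"
  assumes n: "0 \<le> s ''n'' 0" "s ''n'' 0 + 1 \<le> int N"
    and nonneg: "\<And>x y. (x, y) \<in> E \<Longrightarrow> 0 \<le> slack s x y"
  shows "wp N find_min
     (\<lambda>s'. minimizes E (slack s) (s' ''delta'' 0) (s' ''src'' 0) (s' ''dst'' 0)) s"
proof -
  let ?n = "s ''n'' 0"
  let ?I = "\<lambda>k s'. minimizes {(x, y) \<in> E. x < k} (slack s) (s' ''delta'' 0) (s' ''src'' 0) (s' ''dst'' 0)"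
  let ?J = "\<lambda>k l s'. minimizes {(x, y) \<in> E. x < k \<or> x = k \<and> y < l} (slack s)
              (s' ''delta'' 0) (s' ''src'' 0) (s' ''dst'' 0)"
  show ?thesis
    unfolding find_min_def wp.simps
  proof (rule wp_For[where I = ?I], goal_cases)
    case 6
    have "{(x, y) \<in> E. x < 0} = {}" by (auto simp: E_def)
    then show ?case by (simp add: minimizes_def)
  next
    case (7 k s1)
    note outer = 7
    then have eq: "s1 ''n'' = s ''n''" "s1 ''stamp'' = s ''stamp''" 
      by (simp_all add: agree_def)
    show ?case
    proof (cases "0 < s ''stamp'' k")
      case False
      then have "{(x, y) \<in> E. x < k + 1} = {(x, y) \<in> E. x < k}"
        by (auto simp: E_def) (smt (verit))
      with False 7 eq show ?thesis by simp
    next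
      case True
      have "wp N (For ''j'' 1 ''n''
           (Cond (Less (Elem ''stamp'' (Var ''j'')) (Const 1))
             (''slack'' ::= Sub (Add (Elem ''u'' (Elem ''mate'' (Var ''i''))) (Elem ''v'' (Var ''j'')))
                 (Elem ''w'' (Add (Elem ''base'' (Elem ''mate'' (Var ''i''))) (Var ''j''))) ;;
              Cond (Conj (Neg (Less (Var ''delta'') (Const 0))) (Neg (Less (Var ''slack'') (Var ''delta''))))
                Skip
                (''delta'' ::= Var ''slack'' ;; ''src'' ::= Var ''i'' ;; ''dst'' ::= Var ''j''))
             Skip)) (\<lambda>s''. ?I (k + 1) (s''(''i'' := (s'' ''i'')(0 := k + 1)))) s1"
      proof (rule wp_For[where I = "?J k"], goal_cases)
        case 6
        have "{(x, y) \<in> E. x < k \<or> x = k \<and> y < 1} = {(x, y) \<in> E. x < k}" by (auto simp: E_def)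
        then show ?case using 7 by simp
      next
        case (7 l s2)
        have eq2: "s2 ''n'' = s ''n''" "s2 ''stamp'' = s ''stamp''" "s2 ''u'' = s ''u''" "s2 ''v'' = s ''v''"
          "s2 ''mate'' = s ''mate''" "s2 ''base'' = s ''base''" "s2 ''w'' = s ''w''" "s2 ''i'' 0 = k"
          using 7(4) outer(3,4) by (simp_all add: agree_def)
        let ?E = "{(x, y) \<in> E. x < k \<or> x = k \<and> y < l}" and ?E' = "{(x, y) \<in> E. x < k \<or> x = k \<and> y < l + 1}"
        have m: "minimizes ?E (slack s) (s2 ''delta'' 0) (s2 ''src'' 0) (s2 ''dst'' 0)"
          using 7(5) by simp
        show ?case
        proof (cases "s ''stamp'' l < 1")
          case False
          then have "?E' = ?E" by (auto simp: E_def) (smt (verit))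
          with False m 7(3) eq2 show ?thesis by simp
        next
          case st: True
          have kl: "(k, l) \<in> E"
            using True st 7(1,2) outer(1,2) eq by (auto simp: E_def)
          then have E': "?E' = insert (k, l) ?E" by auto
          have sl: "s2 ''u'' (s2 ''mate'' (s2 ''i'' 0)) + s2 ''v'' (s2 ''j'' 0) -
                  s2 ''w'' (s2 ''base'' (s2 ''mate'' (s2 ''i'' 0)) + s2 ''j'' 0) = slack s k l"
            using 7(3) eq2 by (simp add: edge_weight_def)
          show ?thesis
          proof (cases "s2 ''delta'' 0 < 0 \<or> slack s k l < s2 ''delta'' 0")
            case True
            from minimizes_better[OF m nonneg[OF kl] True] show ?thesis
              using True st 7(3) eq2 sl unfolding E' by auto
          next
            case False
            from minimizes_keep[OF m False] show ?thesis
              using False st 7(3) eq2 sl unfolding E' by simp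
          qed
        qed
      next
        case (8 s2)
        have "{(x, y) \<in> E. x < k \<or> x = k \<and> y < s1 ''n'' 0 + 1} = {(x, y) \<in> E. x < k + 1}"
          using eq by (auto simp: E_def)
        with 8 show ?case by simp
      qed (use n eq in simp_all)
      then show ?thesis using True 7 eq by simp
    qed
  next
    case (8 s')
    have "{(x, y) \<in> E. x < ?n + 1} = E" by (auto simp: E_def)
    with 8 show ?case by simp
  qed (use n in simp_all)
qed


definition shift_duals :: com where
  "shift_duals =
     For ''i'' 0 ''n''
       (Cond (Less (Const 0) (Elem ''stamp'' (Var ''i'')))
         (Assign ''u'' (Elem ''mate'' (Var ''i''))
            (Sub (Elem ''u'' (Elem ''mate'' (Var ''i''))) (Var ''delta'')) ;;
          Assign ''v'' (Var ''i'') (Add (Elem ''v'' (Var ''i'')) (Var ''delta'')))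
         Skip)"

lemma writes_shift_duals [simp]: "writes shift_duals = {''i'', ''u'', ''v''}"
  by (auto simp: shift_duals_def)

lemma lower_rows_insert:
  "p k \<notin> p ` X \<Longrightarrow> lower_rows (insert k X) p \<delta> u = (lower_rows X p \<delta> u)(p k := lower_rows X p \<delta> u (p k) - \<delta>)"
  by (auto simp: lower_rows_def)

lemma raise_columns_insert:
  "k \<notin> X \<Longrightarrow> raise_columns (insert k X) \<delta> v = (raise_columns X \<delta> v)(k := raise_columns X \<delta> v k + \<delta>)"
  by (auto simp: raise_columns_def)

text \<open>
  The loop visits the columns of the tree, not the rows. Injectivity of \<open>mate\<close> ensures that no
  row is lowered twice.
\<close>

lemma wp_shift_duals:
  fixes s :: state
  defines "X \<equiv> reached (s ''n'' 0) (s ''stamp'')"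
  assumes n: "0 \<le> s ''n'' 0" "s ''n'' 0 + 1 \<le> int N"
    and inj: "inj_on (s ''mate'') X"
  shows "wp N shift_duals
     (\<lambda>s'. s' ''u'' = lower_rows X (s ''mate'') (s ''delta'' 0) (s ''u'') \<and>
           s' ''v'' = raise_columns X (s ''delta'' 0) (s ''v'')) s"
proof -
  let ?X = "\<lambda>k. {x\<in>X. x < k}"
  show ?thesis
    unfolding shift_duals_def
  proof (rule wp_For[where I = "\<lambda>k s'.
      s' ''u'' = lower_rows (?X k) (s ''mate'') (s ''delta'' 0) (s ''u'') \<and>
      s' ''v'' = raise_columns (?X k) (s ''delta'' 0) (s ''v'')"], goal_cases)
    case 6
    have "?X 0 = {}" by (auto simp: X_def)
    show ?case unfolding \<open>?X 0 = {}\<close> by (simp add: lower_rows_def raise_columns_def)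
  next
    case (7 k s')
    then have eq: "s' ''stamp'' = s ''stamp''" "s' ''mate'' = s ''mate''" "s' ''delta'' = s ''delta''"
      by (simp_all add: agree_def)
    show ?case
    proof (cases "0 < s ''stamp'' k")
      case True
      then have k: "k \<in> X" using 7 by (simp add: X_def)
      then have X: "?X (k + 1) = insert k (?X k)" by auto
      have "s ''mate'' k \<notin> s ''mate'' ` ?X k" using inj k by (auto dest: inj_onD)
      from lower_rows_insert[where X = "?X k" and p = "s ''mate''", OF this]
      show ?thesis
        using 7 True eq raise_columns_insert[of k "?X k"] unfolding X by (auto simp: fun_eq_iff)
    next
      case False
      then have "?X (k + 1) = ?X k" by (auto simp: X_def) (smt (verit))
      then show ?thesis using 7 False eq by simp
    qed
  next
    case (8 s')
    have "?X (s ''n'' 0 + 1) = X" by (auto simp: X_def)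
    with 8 show ?case by simp
  qed (use n in simp_all)
qed

text \<open>
  One column is added per iteration. It receives the stamp after that of \<open>cur\<close>, the latest
  column, and the search ends when the latest column is free.
\<close>

definition grow :: com where
  "grow =
     While (Less (Const 0) (Elem ''mate'' (Var ''cur'')))
       (find_min ;; shift_duals ;;
        Assign ''way'' (Var ''dst'') (Var ''src'') ;;
        Assign ''stamp'' (Var ''dst'') (Add (Elem ''stamp'' (Var ''cur'')) (Const 1)) ;;
        ''cur'' ::= Var ''dst'')"

lemma writes_grow [simp]:
  "writes grow = {''delta'', ''i'', ''j'', ''slack'', ''src'', ''dst'', ''u'', ''v'', ''way'', ''stamp'', ''cur''}"
  by (auto simp: grow_def)

abbreviation tree_in :: "state \<Rightarrow> int \<Rightarrow> bool" where
  "tree_in s r \<equiv> alternating_tree (s ''n'' 0) (edge_weight s) r (s ''u'') (s ''v'') (s ''mate'') (s ''way'')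
     (s ''stamp'') (s ''cur'' 0)"

text \<open>
  While the latest column is matched, every column of the tree has a row, so its slacks are
  slacks of actual edges.
\<close>

lemma tree_in_slack_nonneg:
  assumes t: "tree_in s r" and c: "s ''mate'' (s ''cur'' 0) \<noteq> 0"
    and x: "x \<in> reached (s ''n'' 0) (s ''stamp'')" and y: "y \<in> {1..s ''n'' 0}"
  shows "0 \<le> slack s x y"
proof -
  have "s ''mate'' x \<noteq> 0" using t c x unfolding alternating_tree_def by blast
  moreover have "assigns {0..s ''n'' 0} (s ''mate'') r" using t by (simp add: alternating_tree_def)
  ultimately have "s ''mate'' x \<in> {1..r}" 
    using x assigns_mem[of "{0..s ''n'' 0}" "s ''mate''" r x] by simp
  moreover have "r \<le> s ''n'' 0" "feasible (s ''n'' 0) (edge_weight s) (s ''u'') (s ''v'')"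
    using t by (simp_all add: alternating_tree_def)
  ultimately show ?thesis using y by (auto simp: feasible_def)
qed

lemma tree_in_mate_inj:
  assumes t: "tree_in s r" and c: "s ''mate'' (s ''cur'' 0) \<noteq> 0"
  shows "inj_on (s ''mate'') (reached (s ''n'' 0) (s ''stamp''))"
proof (rule inj_onI)
  fix x y
  assume xy: "x \<in> reached (s ''n'' 0) (s ''stamp'')" "y \<in> reached (s ''n'' 0) (s ''stamp'')"
    "s ''mate'' x = s ''mate'' y"
  have "s ''mate'' x \<noteq> 0" using t c xy(1) unfolding alternating_tree_def by blast
  moreover have "assigns {0..s ''n'' 0} (s ''mate'') r" using t by (simp add: alternating_tree_def)
  ultimately show "x = y"
    using xy assigns_inj[of "{0..s ''n'' 0}" "s ''mate''" r x y] by simp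
qed

lemma wp_grow:
  assumes n: "s ''n'' 0 + 2 \<le> int N" and t: "tree_in s r"
  shows "wp N grow (\<lambda>s'. tree_in s' r \<and> s' ''mate'' (s' ''cur'' 0) = 0) s"
proof -
  let ?n = "s ''n'' 0"
  show ?thesis
    unfolding grow_def
  proof (rule wp_While[where I = "\<lambda>s'. agree (writes grow) s s' \<and> tree_in s' r"
        and \<mu> = "\<lambda>s'. nat (?n + 2 - s' ''stamp'' (s' ''cur'' 0))"], goal_cases)
    case 1
    show ?case using t by (simp add: agree_def)
  next
    case 2
    have "0 < s ''stamp'' (s ''cur'' 0)" using t by (simp add: alternating_tree_def)
    then show ?case using n by linarith
  next
    case (3 s1)
    let ?c = "s1 ''cur'' 0"
    let ?E = "{(x, y). x \<in> reached (s1 ''n'' 0) (s1 ''stamp'') \<and> y \<in> {1..s1 ''n'' 0} \<and> s1 ''stamp'' y \<le> 0}"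
    have n1: "s1 ''n'' = s ''n''" using 3 by (simp add: agree_def)
    have t1: "tree_in s1 r" and c: "s1 ''mate'' ?c \<noteq> 0" using 3 by auto
    have npos: "0 \<le> ?n" using t by (simp add: alternating_tree_def)
    have ne: "?E \<noteq> {}"
    proof -
      obtain y where "y \<in> {1..s1 ''n'' 0}" "s1 ''stamp'' y = 0" using tree_unreached[OF t1 c] by blast
      moreover have "0 \<in> reached (s1 ''n'' 0) (s1 ''stamp'')" using t1 by (simp add: alternating_tree_def)
      ultimately have "(0, y) \<in> ?E" by simp
      then show ?thesis by blast
    qed
    have "wp N find_min
       (\<lambda>s'. minimizes ?E (slack s1) (s' ''delta'' 0) (s' ''src'' 0) (s' ''dst'' 0)) s1"
      using tree_in_slack_nonneg[OF t1 c] n n1 npos by (intro wp_find_min) auto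
    then show ?case
      unfolding wp.simps(3)
    proof (rule wp_conseq)
      fix s2
      assume min: "minimizes ?E (slack s1) (s2 ''delta'' 0) (s2 ''src'' 0) (s2 ''dst'' 0)"
        and ag2: "agree (writes find_min) s1 s2"
      have eq2: "s2 ''n'' = s1 ''n''" "s2 ''stamp'' = s1 ''stamp''" "s2 ''u'' = s1 ''u''" "s2 ''v'' = s1 ''v''"
          "s2 ''mate'' = s1 ''mate''" "s2 ''base'' = s1 ''base''" "s2 ''w'' = s1 ''w''"
          "s2 ''cur'' = s1 ''cur''" "s2 ''way'' = s1 ''way''"
        using ag2 by (simp_all add: agree_def)
      have ew: "edge_weight s2 = edge_weight s1" using eq2 by (simp add: edge_weight_def fun_eq_iff)
      let ?x = "s2 ''src'' 0" and ?y = "s2 ''dst'' 0" and ?\<delta> = "s2 ''delta'' 0"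
      let ?X = "reached (s1 ''n'' 0) (s1 ''stamp'')"
      have xy: "(?x, ?y) \<in> ?E" "?\<delta> = slack s1 ?x ?y" "\<And>x y. (x, y) \<in> ?E \<Longrightarrow> ?\<delta> \<le> slack s1 x y"
        using minimizesD[OF min ne] by blast+
      have "s1 ''stamp'' ?y = 0" using xy(1) t1 by (auto simp: alternating_tree_def intro: antisym)
      then have t3: "alternating_tree (s1 ''n'' 0) (edge_weight s1) r (lower_rows ?X (s1 ''mate'') ?\<delta> (s1 ''u''))
         (raise_columns ?X ?\<delta> (s1 ''v'')) (s1 ''mate'') ((s1 ''way'')(?y := ?x))
         ((s1 ''stamp'')(?y := s1 ''stamp'' ?c + 1)) ?y"
        using xy by (intro tree_extend[OF t1 c]) auto
      have "wp N shift_duals (\<lambda>s'. s' ''u'' = lower_rows ?X (s1 ''mate'') ?\<delta> (s1 ''u'') \<and>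
           s' ''v'' = raise_columns ?X ?\<delta> (s1 ''v'')) s2"
        using wp_shift_duals[of s2 N] n npos n1 tree_in_mate_inj[OF t1 c] by (simp add: eq2)
      then show "wp N shift_duals (wp N (Assign ''way'' (Var ''dst'') (Var ''src''))
         (wp N (Assign ''stamp'' (Var ''dst'') (Add (Elem ''stamp'' (Var ''cur'')) (Const 1)))
           (wp N (''cur'' ::= Var ''dst'')
             (\<lambda>s'. (agree (writes grow) s s' \<and> tree_in s' r) \<and>
               nat (?n + 2 - s' ''stamp'' (s' ''cur'' 0)) < nat (?n + 2 - s1 ''stamp'' (s1 ''cur'' 0)))))) s2"
      proof (rule wp_conseq)
        fix s3
        assume uv: "s3 ''u'' = lower_rows ?X (s1 ''mate'') ?\<delta> (s1 ''u'') \<and>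
           s3 ''v'' = raise_columns ?X ?\<delta> (s1 ''v'')" and ag3: "agree (writes shift_duals) s2 s3"
        have eq3: "s3 ''n'' = s1 ''n''" "s3 ''stamp'' = s1 ''stamp''" 
          "s3 ''mate'' = s1 ''mate''" "s3 ''base'' = s1 ''base''" "s3 ''w'' = s1 ''w''"
          "s3 ''cur'' = s1 ''cur''" "s3 ''way'' = s1 ''way''" "s3 ''src'' 0 = ?x" "s3 ''dst'' 0 = ?y"
          using ag3 by (simp_all add: agree_def eq2)
        let ?s = "s3(''way'' := (s3 ''way'')(?y := ?x),
           ''stamp'' := (s3 ''stamp'')(?y := s3 ''stamp'' ?c + 1), ''cur'' := (s3 ''cur'')(0 := ?y))"
        have "edge_weight ?s = edge_weight s1" using eq3 by (simp add: edge_weight_def fun_eq_iff)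
        then have "tree_in ?s r" using t3 uv eq3 by simp
        moreover have "agree (writes grow) s ?s"
          using 3(1) ag2 ag3 by (simp add: agree_def)
        moreover have "s1 ''stamp'' ?c \<le> ?n + 1" using tree_stamp_le[OF t1] n1 by simp
        ultimately show "wp N (Assign ''way'' (Var ''dst'') (Var ''src''))
         (wp N (Assign ''stamp'' (Var ''dst'') (Add (Elem ''stamp'' (Var ''cur'')) (Const 1)))
           (wp N (''cur'' ::= Var ''dst'')
             (\<lambda>s'. (agree (writes grow) s s' \<and> tree_in s' r) \<and>
               nat (?n + 2 - s' ''stamp'' (s' ''cur'' 0)) < nat (?n + 2 - s1 ''stamp'' (s1 ''cur'' 0))))) s3"
          using eq3 by (simp del: writes_grow)
      qed
    qed
  next
    case (4 s1)
    have "s1 ''mate'' (s1 ''cur'' 0) = 0"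
    proof (rule ccontr)
      assume "s1 ''mate'' (s1 ''cur'' 0) \<noteq> 0"
      then have "s1 ''mate'' (s1 ''cur'' 0) \<in> {1..r}"
        using 4 assigns_mem[of "{0..s1 ''n'' 0}" "s1 ''mate''" r "s1 ''cur'' 0"] by (simp add: alternating_tree_def)
      then show False using 4 by simp
    qed
    then show ?case using 4 by simp
  qed
qed


definition augment :: com where
  "augment =
     While (Less (Const 0) (Var ''cur''))
       (Assign ''mate'' (Var ''cur'') (Elem ''mate'' (Elem ''way'' (Var ''cur''))) ;;
        ''cur'' ::= Elem ''way'' (Var ''cur''))"

lemma writes_augment [simp]: "writes augment = {''cur'', ''mate''}"
  by (auto simp: augment_def)

abbreviation hole_in :: "state \<Rightarrow> int \<Rightarrow> bool" where
  "hole_in s r \<equiv> hole (s ''n'' 0) (edge_weight s) r (s ''u'') (s ''v'') (s ''mate'') (s ''way'')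
     (s ''stamp'') (s ''cur'' 0)"

definition matched :: "state \<Rightarrow> int \<Rightarrow> bool" where
  "matched s r \<longleftrightarrow> feasible (s ''n'' 0) (edge_weight s) (s ''u'') (s ''v'') \<and>
     tight_on {1..s ''n'' 0} (edge_weight s) (s ''u'') (s ''v'') (s ''mate'') \<and>
     assigns {1..s ''n'' 0} (s ''mate'') r"

text \<open>
  The stamp of the hole decreases with each step, and it is at most \<open>n + 1\<close> in the tree.
\<close>

lemma wp_augment:
  assumes h: "hole_in s r" and N: "s ''stamp'' (s ''cur'' 0) \<le> int N"
  shows "wp N augment (\<lambda>s'. matched s' r) s"
  unfolding augment_def
proof (rule wp_While[where I = "\<lambda>s'. hole_in s' r" and \<mu> = "\<lambda>s'. nat (s' ''stamp'' (s' ''cur'' 0))"], goal_cases)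
  case (3 s1)
  let ?c = "s1 ''cur'' 0"
  let ?s = "s1(''mate'' := (s1 ''mate'')(?c := s1 ''mate'' (s1 ''way'' ?c)),
               ''cur'' := (s1 ''cur'')(0 := s1 ''way'' ?c))"
  have c: "?c \<noteq> 0" using 3 by simp
  have "edge_weight ?s = edge_weight s1" by (simp add: edge_weight_def fun_eq_iff)
  then have "hole_in ?s r" using hole_step(1)[OF 3(1) c] by simp
  moreover have "nat (?s ''stamp'' (?s ''cur'' 0)) < nat (s1 ''stamp'' ?c)"
    using hole_step(2)[OF 3(1) c] 3(1) by (simp add: hole_def)
  ultimately show ?case by simp
next
  case (4 s1)
  then have "s1 ''cur'' 0 = 0" by (simp add: hole_def)
  then show ?case using hole_end[of "s1 ''n'' 0"] 4 by (simp add: matched_def)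
qed (use assms in simp_all)

text \<open>
  Row \<open>r\<close> is parked at the dummy column 0, which becomes the root of the tree.
\<close>

definition phase :: com where
  "phase =
     Assign ''mate'' (Const 0) (Var ''r'') ;; ''cur'' ::= Const 0 ;;
     For ''j'' 1 ''n'' (Assign ''stamp'' (Var ''j'') (Const 0)) ;;
     Assign ''stamp'' (Const 0) (Const 1) ;; grow ;; augment"

definition hungarian :: com where
  "hungarian = For ''r'' 1 ''n'' phase"

lemma writes_phase [simp]: "writes phase = writes grow \<union> {''mate''}"
  by (auto simp: phase_def)

lemma wp_phase:
  assumes n: "s ''n'' 0 + 2 \<le> int N" and r: "1 \<le> r" "r \<le> s ''n'' 0" "s ''r'' 0 = r"
    and m: "matched s (r - 1)"
  shows "wp N phase (\<lambda>s'. matched s' r) s"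
proof -
  let ?s = "s(''mate'' := (s ''mate'')(0 := r), ''cur'' := (s ''cur'')(0 := 0))"
  have "wp N (For ''j'' 1 ''n'' (Assign ''stamp'' (Var ''j'') (Const 0)))
    (\<lambda>s'. \<forall>j\<in>{1..s ''n'' 0}. s' ''stamp'' j = 0) ?s"
  proof (rule wp_For[where I = "\<lambda>k s'. \<forall>j\<in>{1..<k}. s' ''stamp'' j = 0"], goal_cases)
    case (7 k s1)
    then show ?case by (auto simp: less_le)
  qed (use n r in simp_all)
  then have "wp N (For ''j'' 1 ''n'' (Assign ''stamp'' (Var ''j'') (Const 0)))
    (wp N (Assign ''stamp'' (Const 0) (Const 1)) (wp N grow (wp N augment (\<lambda>s'. matched s' r)))) ?s"
  proof (rule wp_conseq)
    fix s1
    assume st: "\<forall>j\<in>{1..s ''n'' 0}. s1 ''stamp'' j = 0"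
      and ag: "agree (writes (For ''j'' 1 ''n'' (Assign ''stamp'' (Var ''j'') (Const 0)))) ?s s1"
    let ?s1 = "s1(''stamp'' := (s1 ''stamp'')(0 := 1))"
    have eq: "s1 ''n'' = s ''n''" "s1 ''u'' = s ''u''" "s1 ''v'' = s ''v''" "s1 ''w'' = s ''w''"
      "s1 ''base'' = s ''base''" "s1 ''mate'' = (s ''mate'')(0 := r)" "s1 ''cur'' 0 = 0"
      using ag by (simp_all add: agree_def)
    have "edge_weight ?s1 = edge_weight s" using eq by (simp add: edge_weight_def fun_eq_iff)
    moreover have "alternating_tree (s ''n'' 0) (edge_weight s) r (s ''u'') (s ''v'') ((s ''mate'')(0 := r)) (s1 ''way'')
       ((s1 ''stamp'')(0 := 1)) 0"
      using m r st unfolding matched_def by (intro tree_start) auto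
    ultimately have "tree_in ?s1 r" using eq by simp
    then have "wp N grow (\<lambda>s'. tree_in s' r \<and> s' ''mate'' (s' ''cur'' 0) = 0) ?s1"
      using n eq by (intro wp_grow) simp_all
    then have "wp N grow (wp N augment (\<lambda>s'. matched s' r)) ?s1"
    proof (rule wp_conseq)
      fix s2
      assume t: "tree_in s2 r \<and> s2 ''mate'' (s2 ''cur'' 0) = 0" and ag2: "agree (writes grow) ?s1 s2"
      have "s2 ''n'' = s ''n''" using ag2 eq by (simp add: agree_def)
      then have "s2 ''stamp'' (s2 ''cur'' 0) \<le> int N"
        using tree_stamp_le[of "s2 ''n'' 0"] t n by fastforce
      with hole_start[of "s2 ''n'' 0"] t show "wp N augment (\<lambda>s'. matched s' r) s2"
        by (intro wp_augment) simp_all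
    qed
    then show "wp N (Assign ''stamp'' (Const 0) (Const 1)) (wp N grow (wp N augment (\<lambda>s'. matched s' r))) s1"
      by simp
  qed
  then show ?thesis using r by (simp add: phase_def)
qed

text \<open>
  The side condition \<open>n + 2 \<le> N\<close> stems from the stamps, which range up to \<open>n + 1\<close>.
\<close>

lemma wp_hungarian:
  assumes n: "0 \<le> s ''n'' 0" "s ''n'' 0 + 2 \<le> int N" and m: "matched s 0"
  shows "wp N hungarian (\<lambda>s'. matched s' (s ''n'' 0)) s"
  unfolding hungarian_def
proof (rule wp_For[where I = "\<lambda>k s'. matched s' (k - 1)"], goal_cases)
  case 6
  show ?case using m by (simp add: matched_def edge_weight_def)
next
  case (7 k s1)
  then have "s1 ''n'' = s ''n''" by (simp add: agree_def)
  with 7 n have "wp N phase (\<lambda>s'. matched s' k) s1" by (intro wp_phase) simp_all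
  then show ?case by (rule wp_mono) (simp add: matched_def edge_weight_def)
qed (use n in simp_all)

lemma writes_hungarian [simp]: "writes hungarian = writes phase \<union> {''r''}"
  by (auto simp: hungarian_def)

text \<open>
  Sets \<open>base\<close> for the next weight matrix and starts with feasible prices: \<open>v = 0\<close>, and \<open>u i\<close> is
  the sum of row \<open>i\<close>, which dominates each of its entries because weights are nonnegative. The
  pointer \<open>ptr\<close> moves on from one matrix to the next.
\<close>

definition prepare :: com where
  "prepare =
     For ''i'' 1 ''n''
       (Assign ''base'' (Var ''i'') (Var ''ptr'') ;;
        ''ptr'' ::= Add (Var ''ptr'') (Var ''n'') ;;
        Assign ''u'' (Var ''i'') (Const 0) ;;
        Assign ''v'' (Var ''i'') (Const 0) ;;
        Assign ''mate'' (Var ''i'') (Const 0) ;;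
        For ''j'' 1 ''n''
          (Assign ''u'' (Var ''i'') (Add (Elem ''u'' (Var ''i''))
             (Elem ''w'' (Add (Elem ''base'' (Var ''i'')) (Var ''j''))))))"

lemma writes_prepare [simp]: "writes prepare = {''i'', ''base'', ''ptr'', ''u'', ''v'', ''mate'', ''j''}"
  by (auto simp: prepare_def)

lemma wp_prepare:
  assumes n: "0 \<le> s ''n'' 0" "s ''n'' 0 \<le> int N" and w: "\<And>a. 0 \<le> s ''w'' a"
  shows "wp N prepare (\<lambda>s'. matched s' 0 \<and>
     s' ''ptr'' 0 = s ''ptr'' 0 + s ''n'' 0 * s ''n'' 0 \<and>
     (\<forall>i\<in>{1..s ''n'' 0}. s' ''base'' i = s ''ptr'' 0 + (i - 1) * s ''n'' 0)) s"
proof -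
  let ?n = "s ''n'' 0"
  let ?I = "\<lambda>k s'. s' ''ptr'' 0 = s ''ptr'' 0 + (k - 1) * ?n \<and>
    (\<forall>i\<in>{1..<k}. s' ''base'' i = s ''ptr'' 0 + (i - 1) * ?n \<and> s' ''v'' i = 0 \<and> s' ''mate'' i = 0 \<and>
       (\<forall>j\<in>{1..?n}. s ''w'' (s ''ptr'' 0 + (i - 1) * ?n + j) \<le> s' ''u'' i))"
  show ?thesis
    unfolding prepare_def
  proof (rule wp_For[where I = ?I], goal_cases)
    case (7 k s1)
    have eq: "s1 ''n'' = s ''n''" "s1 ''w'' = s ''w''" using 7 by (simp_all add: agree_def)
    let ?s = "s1(''base'' := (s1 ''base'')(k := s1 ''ptr'' 0), ''ptr'' := (s1 ''ptr'')(0 := s1 ''ptr'' 0 + ?n),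
      ''u'' := (s1 ''u'')(k := 0), ''v'' := (s1 ''v'')(k := 0), ''mate'' := (s1 ''mate'')(k := 0))"
    have "wp N (For ''j'' 1 ''n''
          (Assign ''u'' (Var ''i'') (Add (Elem ''u'' (Var ''i''))
             (Elem ''w'' (Add (Elem ''base'' (Var ''i'')) (Var ''j''))))))
         (\<lambda>s''. ?I (k + 1) (s''(''i'' := (s'' ''i'')(0 := k + 1)))) ?s"
    proof (rule wp_For[where I = "\<lambda>l s'. 0 \<le> s' ''u'' k \<and> (\<forall>j\<in>{1..<l}. s ''w'' (s1 ''ptr'' 0 + j) \<le> s' ''u'' k) \<and>
          (\<forall>i. i \<noteq> k \<longrightarrow> s' ''u'' i = s1 ''u'' i)"], goal_cases)
      case (7 l s2)
      have eq2: "s2 ''w'' = s ''w''" "s2 ''base'' k = s1 ''ptr'' 0" "s2 ''i'' 0 = k"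
        using 7(4) eq \<open>s1 ''i'' 0 = k\<close> by (simp_all add: agree_def)
      have "s ''w'' (s1 ''ptr'' 0 + j) \<le> s2 ''u'' k + s ''w'' (s1 ''ptr'' 0 + l)" if "j \<in> {1..<l + 1}" for j
      proof (cases "j = l")
        case True
        then show ?thesis using 7(5) by simp
      next
        case False
        then have "s ''w'' (s1 ''ptr'' 0 + j) \<le> s2 ''u'' k" using 7(5) that by simp
        then show ?thesis using w[of "s1 ''ptr'' 0 + l"] by linarith
      qed
      then show ?case using 7(3,5) eq2 w[of "s1 ''ptr'' 0 + l"] by simp
    next
      case (8 s2)
      have eq2: "s2 ''base'' = (s1 ''base'')(k := s1 ''ptr'' 0)" "s2 ''ptr'' 0 = s1 ''ptr'' 0 + ?n"
        "s2 ''v'' = (s1 ''v'')(k := 0)" "s2 ''mate'' = (s1 ''mate'')(k := 0)"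
        using 8(1) by (simp_all add: agree_def)
      have row: "s2 ''base'' i = s ''ptr'' 0 + (i - 1) * ?n \<and> s2 ''v'' i = 0 \<and> s2 ''mate'' i = 0 \<and>
         (\<forall>j\<in>{1..?n}. s ''w'' (s ''ptr'' 0 + (i - 1) * ?n + j) \<le> s2 ''u'' i)" if "i \<in> {1..<k + 1}" for i
      proof (cases "i = k")
        case True
        then show ?thesis using 7(5) 8(2) eq eq2 by auto
      next
        case False
        then have "i \<in> {1..<k}" using that by auto
        then have "s1 ''base'' i = s ''ptr'' 0 + (i - 1) * ?n \<and> s1 ''v'' i = 0 \<and> s1 ''mate'' i = 0 \<and>
          (\<forall>j\<in>{1..?n}. s ''w'' (s ''ptr'' 0 + (i - 1) * ?n + j) \<le> s1 ''u'' i)"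
          using 7(5) by blast
        moreover have "s2 ''u'' i = s1 ''u'' i" using 8(2) False by blast
        ultimately show ?thesis using False unfolding eq2 by auto
      qed
      have "s2 ''ptr'' 0 = s ''ptr'' 0 + (k + 1 - 1) * ?n"
        using 7(5) eq2 by (simp add: algebra_simps)
      with row show ?case by simp
    qed (use n eq in simp_all)
    then show ?case using 7(3) eq by simp
  next
    case (8 s1)
    have eq: "s1 ''n'' = s ''n''" "s1 ''w'' = s ''w''" using 8 by (simp_all add: agree_def)
    have "{j \<in> {1..?n}. s1 ''mate'' j \<noteq> 0} = {}" using 8 by auto
    then have "assigns {1..?n} (s1 ''mate'') 0"
      unfolding assigns_def by (simp only:) (simp add: bij_betw_def)
    then show ?case
      using 8(2) eq by (simp add: matched_def feasible_def tight_on_def edge_weight_def)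
  qed (use n in simp_all)
qed

definition evaluate :: com where
  "evaluate = ''sum'' ::= Const 0 ;;
     For ''j'' 1 ''n'' (''sum'' ::= Add (Var ''sum'')
       (Elem ''w'' (Add (Elem ''base'' (Elem ''mate'' (Var ''j''))) (Var ''j''))))"

lemma writes_evaluate [simp]: "writes evaluate = {''sum'', ''j''}"
  by (auto simp: evaluate_def)

lemma wp_evaluate:
  assumes n: "0 \<le> s ''n'' 0" "s ''n'' 0 \<le> int N"
  shows "wp N evaluate (\<lambda>s'. s' ''sum'' 0 = (\<Sum>j=1..s ''n'' 0. edge_weight s (s ''mate'' j) j)) s"
  unfolding evaluate_def wp.simps
proof (rule wp_For[where I = "\<lambda>k s'. s' ''sum'' 0 = (\<Sum>j=1..k-1. edge_weight s (s ''mate'' j) j)"], goal_cases)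
  case (7 k s1)
  then have "s1 ''w'' = s ''w''" "s1 ''base'' = s ''base''" "s1 ''mate'' = s ''mate''"
    by (simp_all add: agree_def)
  moreover have "{1..k} = insert k {1..k-1}" using 7 by auto
  ultimately show ?case using 7 by (simp add: edge_weight_def)
qed (use n in simp_all)

definition record_best :: com where
  "record_best =
     Cond (Less (Var ''best'') (Var ''sum''))
       (''best'' ::= Var ''sum'' ;;
        For ''j'' 1 ''n'' (Assign ''m'' (Elem ''mate'' (Var ''j'')) (Var ''j'')))
       Skip"

lemma writes_record_best [simp]: "writes record_best = {''best'', ''j'', ''m''}"
  by (auto simp: record_best_def)

lemma wp_record_best:
  assumes n: "0 \<le> s ''n'' 0" "s ''n'' 0 \<le> int N" and inj: "inj_on (s ''mate'') {1..s ''n'' 0}"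
  shows "wp N record_best (\<lambda>s'. if s ''best'' 0 < s ''sum'' 0
      then s' ''best'' 0 = s ''sum'' 0 \<and> (\<forall>j\<in>{1..s ''n'' 0}. s' ''m'' (s ''mate'' j) = j)
      else s' = s) s"
proof (cases "s ''best'' 0 < s ''sum'' 0")
  case True
  let ?s = "s(''best'' := (s ''best'')(0 := s ''sum'' 0))"
  have "wp N (For ''j'' 1 ''n'' (Assign ''m'' (Elem ''mate'' (Var ''j'')) (Var ''j'')))
     (\<lambda>s'. s' ''best'' 0 = s ''sum'' 0 \<and> (\<forall>j\<in>{1..s ''n'' 0}. s' ''m'' (s ''mate'' j) = j)) ?s"
  proof (rule wp_For[where I = "\<lambda>k s'. \<forall>j\<in>{1..<k}. s' ''m'' (s ''mate'' j) = j"], goal_cases)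
    case (7 k s1)
    then have eq: "s1 ''mate'' = s ''mate''" by (simp add: agree_def)
    have "s ''mate'' j = s ''mate'' k \<longleftrightarrow> j = k" if "j \<in> {1..<k + 1}" for j
      using inj_onD[OF inj, of j k] that 7 by auto
    then have "\<forall>j\<in>{1..<k + 1}. ((s1 ''m'')(s ''mate'' k := k)) (s ''mate'' j) = j"
      using 7 by simp
    then show ?case using 7(3) eq by (auto split: if_splits)
  next
    case (8 s1)
    then show ?case by (auto simp: agree_def)
  qed (use n in simp_all)
  then show ?thesis using True by (simp add: record_best_def)
qed (simp add: record_best_def)

section \<open>The best matching over all weight functions\<close>

text \<open>
  The algorithm. The initial value of \<open>ptr\<close> compensates for counting columns from 1 in an array
  that starts at index 0, and \<open>best\<close> starts below every sum of weights, so that the first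
  matching is recorded.
\<close>

definition best_matching :: com where
  "best_matching =
     ''ptr'' ::= Const (-1) ;; ''best'' ::= Const (-1) ;;
     For ''k'' 1 ''d'' (prepare ;; hungarian ;; evaluate ;; record_best)"

text \<open>
  The row-major layout of the input, with all three indices counted from 1.
\<close>

definition layer_weight :: "(int \<Rightarrow> int) \<Rightarrow> int \<Rightarrow> int \<Rightarrow> int \<Rightarrow> int \<Rightarrow> int" where
  "layer_weight f n k i j = f ((k - 1) * (n * n) + (i - 1) * n + j - 1)"

abbreviation total :: "(int \<Rightarrow> int) \<Rightarrow> int \<Rightarrow> int \<Rightarrow> (int \<Rightarrow> int) \<Rightarrow> int" where
  "total f n k p \<equiv> \<Sum>j=1..n. layer_weight f n k (p j) j"

text \<open>
  The invariant after \<open>k - 1\<close> rounds: unless it still has its initial value, \<open>best\<close> is the value,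
  for some earlier weight function, of the recorded assignment, and no assignment has a larger
  value for any earlier weight function.
\<close>

lemma wp_best_matching:
  fixes s :: state
  defines "n \<equiv> s ''n'' 0" and "d \<equiv> s ''d'' 0" and "f \<equiv> s ''w''"
  assumes n: "0 \<le> n" "n + 2 \<le> int N" and d: "0 < d" "d \<le> int N" and w: "\<And>a. 0 \<le> f a"
  shows "wp N best_matching (\<lambda>s'. \<exists>p. bij_betw p {1..n} {1..n} \<and> (\<forall>j\<in>{1..n}. s' ''m'' (p j) = j) \<and>
     (\<exists>k\<in>{1..d}. \<forall>k'\<in>{1..d}. \<forall>q. bij_betw q {1..n} {1..n} \<longrightarrow> total f n k' q \<le> total f n k p)) s"
proof -
  let ?found = "\<lambda>k s'. \<exists>p. bij_betw p {1..n} {1..n} \<and> (\<forall>j\<in>{1..n}. s' ''m'' (p j) = j) \<and>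
     (\<exists>\<kappa>\<in>{1..<k}. s' ''best'' 0 = total f n \<kappa> p)"
  let ?bound = "\<lambda>k s'. \<forall>\<kappa>\<in>{1..<k}. \<forall>q. bij_betw q {1..n} {1..n} \<longrightarrow> total f n \<kappa> q \<le> s' ''best'' 0"
  let ?I = "\<lambda>k s'. s' ''ptr'' 0 = (k - 1) * (n * n) - 1 \<and>
     (s' ''best'' 0 = -1 \<or> ?found k s') \<and> ?bound k s'"
  let ?s = "s(''ptr'' := (s ''ptr'')(0 := -1), ''best'' := (s ''best'')(0 := -1))"
  have "wp N (For ''k'' 1 ''d'' (prepare ;; hungarian ;; evaluate ;; record_best))
    (\<lambda>s'. ?found (d + 1) s' \<and> ?bound (d + 1) s') ?s"
  proof (rule wp_For[where I = ?I], goal_cases)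
    case (7 k s1)
    have eq1: "s1 ''n'' 0 = n" "s1 ''w'' = f" using 7(4) by (simp_all add: agree_def n_def f_def)
    show ?case
      unfolding wp.simps
    proof (rule wp_conseq[OF wp_prepare])
      fix s2
      assume s2: "matched s2 0 \<and> s2 ''ptr'' 0 = s1 ''ptr'' 0 + s1 ''n'' 0 * s1 ''n'' 0 \<and>
          (\<forall>i\<in>{1..s1 ''n'' 0}. s2 ''base'' i = s1 ''ptr'' 0 + (i - 1) * s1 ''n'' 0)"
        and ag2: "agree (writes prepare) s1 s2"
      have eq2: "s2 ''n'' 0 = n" "s2 ''w'' = f" "s2 ''k'' 0 = k" "s2 ''best'' 0 = s1 ''best'' 0" "s2 ''m'' = s1 ''m''"
        using ag2 eq1 7(3) by (simp_all add: agree_def)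
      show "wp N hungarian (wp N evaluate (wp N record_best
              (\<lambda>s''. ?I (k + 1) (s''(''k'' := (s'' ''k'')(0 := k + 1)))))) s2"
      proof (rule wp_conseq[OF wp_hungarian])
        fix s3
        assume m3: "matched s3 (s2 ''n'' 0)" and ag3: "agree (writes hungarian) s2 s3"
        let ?p = "s3 ''mate''"
        have eq3: "s3 ''n'' 0 = n" "s3 ''w'' = f" "s3 ''base'' = s2 ''base''" "s3 ''ptr'' = s2 ''ptr''"
          "s3 ''best'' 0 = s1 ''best'' 0" "s3 ''m'' = s1 ''m''"
          using ag3 eq2 by (simp_all add: agree_def)
        have W: "edge_weight s3 i j = layer_weight f n k i j" if "i \<in> {1..n}" for i j
        proof -
          have "s3 ''base'' i = (k - 1) * (n * n) - 1 + (i - 1) * n"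
            using s2 7(5) eq1 eq3 that by simp
          then have "s3 ''base'' i + j = (k - 1) * (n * n) + (i - 1) * n + j - 1" by simp
          then show ?thesis unfolding edge_weight_def layer_weight_def eq3(2) by (rule arg_cong)
        qed
        have p: "bij_betw ?p {1..n} {1..n}"
          using m3 eq2 eq3 by (intro assigns_all) (simp add: matched_def)
        have sumW: "(\<Sum>j=1..n. edge_weight s3 (q j) j) = total f n k q" if "bij_betw q {1..n} {1..n}" for q
          using bij_betw_apply[OF that] by (intro sum.cong refl W) simp
        have opt: "total f n k q \<le> total f n k ?p" if q: "bij_betw q {1..n} {1..n}" for q
        proof -
          have "(\<Sum>j=1..n. edge_weight s3 (q j) j) \<le> (\<Sum>j=1..n. edge_weight s3 (?p j) j)"
            by (rule tight_assignment_optimal[where u = "s3 ''u''" and v = "s3 ''v''"])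
              (use m3 eq2 eq3 p q in \<open>simp_all add: matched_def\<close>)
          then show ?thesis using sumW[OF q] sumW[OF p] by simp
        qed
        have nonneg: "0 \<le> total f n k ?p" by (intro sum_nonneg) (simp add: layer_weight_def w)
        show "wp N evaluate (wp N record_best
              (\<lambda>s''. ?I (k + 1) (s''(''k'' := (s'' ''k'')(0 := k + 1))))) s3"
        proof (rule wp_conseq[OF wp_evaluate])
          fix s4
          assume "s4 ''sum'' 0 = (\<Sum>j=1..s3 ''n'' 0. edge_weight s3 (s3 ''mate'' j) j)"
            and ag4: "agree (writes evaluate) s3 s4"
          then have sum4: "s4 ''sum'' 0 = total f n k ?p" using eq3 sumW[OF p] by simp
          have eq4: "s4 ''n'' 0 = n" "s4 ''mate'' = ?p" "s4 ''best'' 0 = s1 ''best'' 0" "s4 ''m'' = s1 ''m''"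
            "s4 ''ptr'' 0 = k * (n * n) - 1"
            using ag4 eq3 s2 7(5) eq1 by (simp_all add: agree_def algebra_simps)
          show "wp N record_best (\<lambda>s''. ?I (k + 1) (s''(''k'' := (s'' ''k'')(0 := k + 1)))) s4"
          proof (rule wp_conseq[OF wp_record_best])
            fix s5
            assume s5: "if s4 ''best'' 0 < s4 ''sum'' 0
                then s5 ''best'' 0 = s4 ''sum'' 0 \<and> (\<forall>j\<in>{1..s4 ''n'' 0}. s5 ''m'' (s4 ''mate'' j) = j)
                else s5 = s4"
              and ag5: "agree (writes record_best) s4 s5"
            have ptr: "s5 ''ptr'' 0 = (k + 1 - 1) * (n * n) - 1" using ag5 eq4 by (simp add: agree_def)
            have ge: "s1 ''best'' 0 \<le> s5 ''best'' 0" "total f n k ?p \<le> s5 ''best'' 0"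
              using s5 eq4 sum4 by (auto split: if_splits)
            have "?bound (k + 1) s5"
            proof (intro ballI allI impI)
              fix \<kappa> q assume "\<kappa> \<in> {1..<k + 1}" and q: "bij_betw q {1..n} {1..n}"
              then consider "\<kappa> \<in> {1..<k}" | "\<kappa> = k" by force
              then show "total f n \<kappa> q \<le> s5 ''best'' 0"
              proof cases
                case 1
                then have "total f n \<kappa> q \<le> s1 ''best'' 0" using 7(5) q by blast
                then show ?thesis using ge(1) by (rule order_trans)
              next
                case 2
                show ?thesis unfolding 2 using opt[OF q] ge(2) by (rule order_trans)
              qed
            qed
            moreover have "s5 ''best'' 0 = -1 \<or> ?found (k + 1) s5"
            proof (cases "s1 ''best'' 0 < total f n k ?p")
              case True
              then have "s5 ''best'' 0 = total f n k ?p" "\<forall>j\<in>{1..n}. s5 ''m'' (?p j) = j"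
                using s5 sum4 eq4 by simp_all
              moreover have "k \<in> {1..<k + 1}" using 7(1) by simp
              ultimately show ?thesis using p by blast
            next
              case False
              then have "s5 = s4" using s5 sum4 eq4 by simp
              then have "s5 ''best'' 0 = s1 ''best'' 0" "s5 ''m'' = s1 ''m''" using eq4 by simp_all
              moreover have "{1..<k} \<subseteq> {1..<k + 1}" by auto
              moreover have "s1 ''best'' 0 = -1 \<or> ?found k s1" using 7(5) by blast
              ultimately show ?thesis by (simp only:) blast
            qed
            ultimately show "?I (k + 1) (s5(''k'' := (s5 ''k'')(0 := k + 1)))" using ptr by simp
          qed (use n eq4 p in \<open>simp_all add: bij_betw_def\<close>)
        qed (use n eq3 in simp_all)
      qed (use n eq2 s2 in simp_all)
    qed (use n eq1 w in simp_all)
  next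
    case (8 s')
    have "?s ''d'' 0 + 1 = d + 1" by (simp add: d_def)
    note inv = 8(2)[unfolded this]
    have "s' ''best'' 0 \<noteq> -1"
    proof
      assume "s' ''best'' 0 = -1"
      moreover have "bij_betw (\<lambda>j. j) {1..n} {1..n}" by (simp add: bij_betw_def inj_on_def)
      moreover have "0 \<le> total f n 1 (\<lambda>j. j)" by (intro sum_nonneg) (simp add: layer_weight_def w)
      moreover have "1 \<in> {1..<d + 1}" using d by simp
      moreover have "?bound (d + 1) s'" using inv by blast
      ultimately show False by force
    qed
    with inv show ?case by blast
  qed (use d n in \<open>simp_all add: d_def\<close>)
  then have "wp N best_matching (\<lambda>s'. ?found (d + 1) s' \<and> ?bound (d + 1) s') s"
    by (simp add: best_matching_def)
  then show ?thesis
  proof (rule wp_mono)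
    fix s'
    assume *: "?found (d + 1) s' \<and> ?bound (d + 1) s'"
    have "{1..<d + 1} = {1..d}" by auto
    note ** = *[unfolded this]
    from ** obtain p k where p: "bij_betw p {1..n} {1..n}" "\<forall>j\<in>{1..n}. s' ''m'' (p j) = j"
      and k: "k \<in> {1..d}" "s' ''best'' 0 = total f n k p" by blast
    have "\<forall>k'\<in>{1..d}. \<forall>q. bij_betw q {1..n} {1..n} \<longrightarrow> total f n k' q \<le> total f n k p"
      using ** unfolding k(2) by blast
    with p k(1) show "\<exists>p. bij_betw p {1..n} {1..n} \<and> (\<forall>j\<in>{1..n}. s' ''m'' (p j) = j) \<and>
        (\<exists>k\<in>{1..d}. \<forall>k'\<in>{1..d}. \<forall>q. bij_betw q {1..n} {1..n} \<longrightarrow> total f n k' q \<le> total f n k p)"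
      by blast
  qed
qed

lemma additive_best_matching: "additive best_matching"
  by (simp add: best_matching_def prepare_def hungarian_def evaluate_def record_best_def phase_def
      grow_def augment_def find_min_def shift_duals_def For_def)

section \<open>Perfect matchings as permutations\<close>

text \<open>
  The perfect matchings of \<open>K\<^sub>n\<^sub>,\<^sub>n\<close> are the graphs of permutations, here from columns to rows.
\<close>

definition matching_of :: "nat \<Rightarrow> (int \<Rightarrow> int) \<Rightarrow> (nat \<times> nat) set" where
  "matching_of n q = (\<lambda>j. (nat (q j), nat j)) ` {1..int n}"

lemma perfect_matching_matching_of:
  assumes q: "bij_betw q {1..int n} {1..int n}"
  shows "perfect_matching n (matching_of n q)"
proof -
  have range: "q j \<in> {1..int n}" if "j \<in> {1..int n}" for j
    using bij_betw_apply[OF q that] .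
  have "\<exists>!j. (i, j) \<in> matching_of n q" if i: "i \<in> {1..n}" for i
  proof -
    have "int i \<in> q ` {1..int n}" using q i by (simp add: bij_betw_def)
    then obtain j where j: "j \<in> {1..int n}" "q j = int i" by force
    show ?thesis
    proof (rule ex1I[of _ "nat j"])
      show "(i, nat j) \<in> matching_of n q" using j by (force simp: matching_of_def)
      fix j' assume "(i, j') \<in> matching_of n q"
      then obtain l where l: "l \<in> {1..int n}" "i = nat (q l)" "j' = nat l" by (auto simp: matching_of_def)
      then have "q l = q j" using j range[of l] by auto
      then show "j' = nat j" using q j l by (auto simp: bij_betw_def dest: inj_onD)
    qed
  qed
  moreover have "\<exists>!i. (i, j) \<in> matching_of n q" if j: "j \<in> {1..n}" for j
  proof (rule ex1I[of _ "nat (q (int j))"])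
    show "(nat (q (int j)), j) \<in> matching_of n q"
      using j by (force simp: matching_of_def)
  qed (auto simp: matching_of_def)
  moreover have "matching_of n q \<subseteq> edges n"
    using range by (fastforce simp: matching_of_def edges_def)
  ultimately show ?thesis unfolding perfect_matching_def by blast
qed

lemma perfect_matching_is_matching_of:
  assumes M: "perfect_matching n M"
  obtains q where "bij_betw q {1..int n} {1..int n}" "M = matching_of n q"
proof
  define q where "q j = int (THE i. (i, nat j) \<in> M)" for j
  have edge: "(nat (q j), nat j) \<in> M" if "j \<in> {1..int n}" for j
  proof -
    have "nat j \<in> {1..n}" using that by auto
    then have "\<exists>!i. (i, nat j) \<in> M" using M unfolding perfect_matching_def by blast
    from theI'[OF this] show ?thesis by (simp add: q_def)
  qed
  have "q ` {1..int n} \<subseteq> {1..int n}"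
  proof (rule image_subsetI)
    fix j assume "j \<in> {1..int n}"
    then have "(nat (q j), nat j) \<in> edges n" using edge M unfolding perfect_matching_def by blast
    then show "q j \<in> {1..int n}" by (auto simp: edges_def)
  qed
  moreover have "inj_on q {1..int n}"
  proof (rule inj_onI)
    fix i j assume ij: "i \<in> {1..int n}" "j \<in> {1..int n}" "q i = q j"
    then have "(nat (q i), nat i) \<in> M" "(nat (q i), nat j) \<in> M" using edge by (metis, metis)
    moreover from this have "nat (q i) \<in> {1..n}" using M by (auto simp: perfect_matching_def edges_def)
    ultimately have "nat i = nat j" using M unfolding perfect_matching_def by blast
    then have "int (nat i) = int (nat j)" by simp
    then show "i = j" using ij by simp
  qed
  ultimately show "bij_betw q {1..int n} {1..int n}"
    unfolding bij_betw_def using endo_inj_surj[of "{1..int n}" q] by blast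
  show "M = matching_of n q"
  proof
    show "matching_of n q \<subseteq> M" using edge by (auto simp: matching_of_def)
    show "M \<subseteq> matching_of n q"
    proof
      fix e assume e: "e \<in> M"
      obtain i j where ij: "e = (i, j)" by force
      then have j: "j \<in> {1..n}" using e M by (auto simp: perfect_matching_def edges_def)
      then have "(nat (q (int j)), j) \<in> M" using edge[of "int j"] by simp
      then have "i = nat (q (int j))"
        using e ij j M unfolding perfect_matching_def by blast
      then show "e \<in> matching_of n q" using ij j by (force simp: matching_of_def)
    qed
  qed
qed

lemma weight_matching_of: "weight v (matching_of n q) = (\<Sum>j=1..int n. v (nat (q j), nat j))"
  unfolding weight_def matching_of_def by (subst sum.reindex) (auto simp: inj_on_def)

lemma output_matching_eq:
  assumes p: "bij_betw p {1..int n} {1..int n}" and m: "\<And>j. j \<in> {1..int n} \<Longrightarrow> s ''m'' (p j) = j"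
  shows "output_matching n s = matching_of n p"
proof (rule set_eqI)
  fix e :: "nat \<times> nat"
  obtain i j where e: "e = (i, j)" by force
  have "i \<in> {1..n} \<and> s ''m'' (int i) = int j \<longleftrightarrow> (\<exists>l\<in>{1..int n}. i = nat (p l) \<and> j = nat l)"
  proof
    assume *: "i \<in> {1..n} \<and> s ''m'' (int i) = int j"
    then have "int i \<in> p ` {1..int n}" using p by (simp add: bij_betw_def)
    then obtain l where "l \<in> {1..int n}" "int i = p l" by blast
    then show "\<exists>l\<in>{1..int n}. i = nat (p l) \<and> j = nat l" using * m[of l] by (metis nat_int)
  next
    assume "\<exists>l\<in>{1..int n}. i = nat (p l) \<and> j = nat l"
    then obtain l where l: "l \<in> {1..int n}" "i = nat (p l)" "j = nat l" by blast
    moreover have "p l \<in> {1..int n}" using bij_betw_apply[OF p l(1)] .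
    ultimately show "i \<in> {1..n} \<and> s ''m'' (int i) = int j" using m[of l] by auto
  qed
  then show "e \<in> output_matching n s \<longleftrightarrow> e \<in> matching_of n p"
    unfolding e output_matching_def matching_of_def by auto
qed

lemma layer_weight_input:
  assumes "k \<in> {1..d}" "i \<in> {1..n}" "j \<in> {1..n}"
  shows "layer_weight (input_state d n w ''w'') (int n) (int k) (int i) (int j) = int (w k (i, j))"
proof -
  have "(int k - 1) * (int n * int n) + (int i - 1) * int n + int j - 1 = int (((k - 1) * n + (i - 1)) * n + (j - 1))"
    by (cases k; cases i; cases j) (use assms in \<open>auto simp: algebra_simps\<close>)
  moreover have "input_state d n w ''w'' (int (((k - 1) * n + (i - 1)) * n + (j - 1))) =
      int (w (k - 1 + 1) (i - 1 + 1, j - 1 + 1))"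
    using assms by (intro input_state_weights) auto
  moreover have "k - 1 + 1 = k" "i - 1 + 1 = i" "j - 1 + 1 = j" using assms by auto
  ultimately show ?thesis unfolding layer_weight_def by simp
qed

lemma total_input:
  assumes "k \<in> {1..d}" "bij_betw q {1..int n} {1..int n}"
  shows "total (input_state d n w ''w'') (int n) (int k) q = int (weight (w k) (matching_of n q))"
proof -
  have "layer_weight (input_state d n w ''w'') (int n) (int k) (q j) j = int (w k (nat (q j), nat j))"
    if j: "j \<in> {1..int n}" for j
  proof -
    have "q j \<in> {1..int n}" using bij_betw_apply[OF assms(2) j] .
    then have "nat (q j) \<in> {1..n}" "nat j \<in> {1..n}" "0 \<le> q j" "0 \<le> j"
      using j by (auto simp: le_nat_iff nat_le_iff)
    then show ?thesis using layer_weight_input[OF assms(1), of "nat (q j)" n "nat j" w] by simp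
  qed
  then show ?thesis by (simp add: weight_matching_of)
qed

section \<open>The best component approximates the norm\<close>

lemma component_le_lp_norm:
  assumes p: "1 \<le> p" and k: "k \<in> {1..d}" and y: "\<And>k. 0 \<le> y k"
  shows "y k \<le> lp_norm d p y"
proof (cases "p = \<infinity>")
  case True
  have "\<bar>y k\<bar> \<le> Max ((\<lambda>k. \<bar>y k\<bar>) ` {1..d})" using k by (intro Max_ge) auto
  then show ?thesis using True y[of k] by (simp add: lp_norm_def)
next
  case False
  then obtain r where r: "p = ereal r" "1 \<le> r" using p by (cases p) auto
  have "y k powr r \<le> (\<Sum>k=1..d. \<bar>y k\<bar> powr r)"
    using member_le_sum[OF k, of "\<lambda>k. \<bar>y k\<bar> powr r"] y[of k] by simp
  then have "(y k powr r) powr (1 / r) \<le> (\<Sum>k=1..d. \<bar>y k\<bar> powr r) powr (1 / r)"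
    using r by (intro powr_mono2) auto
  moreover have "(y k powr r) powr (1 / r) = y k" using r y[of k] by (simp add: powr_powr)
  ultimately show ?thesis using r by (simp add: lp_norm_def)
qed

lemma lp_norm_le_max:
  assumes p: "1 \<le> p" and d: "0 < d" and y: "\<And>k. k \<in> {1..d} \<Longrightarrow> 0 \<le> y k \<and> y k \<le> c"
  shows "lp_norm d p y \<le> real d powr real_of_ereal (1 / p) * c"
proof (cases "p = \<infinity>")
  case True
  have "Max ((\<lambda>k. \<bar>y k\<bar>) ` {1..d}) \<le> c" using d y by (subst Max_le_iff) auto
  then show ?thesis using True d by (simp add: lp_norm_def)
next
  case False
  then obtain r where r: "p = ereal r" "1 \<le> r" using p by (cases p) auto
  have c: "0 \<le> c" using y[of 1] d by simp
  have "(\<Sum>k=1..d. \<bar>y k\<bar> powr r) \<le> (\<Sum>k=1..d. c powr r)"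
    using y r by (intro sum_mono powr_mono2) auto
  then have "(\<Sum>k=1..d. \<bar>y k\<bar> powr r) \<le> real d * c powr r" by simp
  then have "(\<Sum>k=1..d. \<bar>y k\<bar> powr r) powr (1 / r) \<le> (real d * c powr r) powr (1 / r)"
    using r by (intro powr_mono2) (auto intro: sum_nonneg)
  also have "\<dots> = real d powr (1 / r) * c"
    using r c by (simp add: powr_mult powr_powr)
  finally show ?thesis using r by (simp add: lp_norm_def one_ereal_def)
qed

lemma finite_perfect_matchings: "finite {M. perfect_matching n M}"
  by (rule finite_subset[of _ "Pow (edges n)"]) (auto simp: perfect_matching_def edges_def)

text \<open>
  Each component of the weight vector of an optimal matching is at most \<open>weight (w k) M\<close>, which
  in turn is a component for \<open>M\<close>. The upper bound in the definition of an approximative solution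
  holds as the ratio is at least 1.
\<close>

lemma approximative_max_best_component:
  fixes w :: "nat \<Rightarrow> nat \<times> nat \<Rightarrow> nat"
  assumes p: "1 \<le> p" and d: "0 < d" and M: "perfect_matching n M" and k: "k \<in> {1..d}"
    and best: "\<And>k' M'. k' \<in> {1..d} \<Longrightarrow> perfect_matching n M' \<Longrightarrow> weight (w k') M' \<le> weight (w k) M"
  shows "approximative_max (real d powr real_of_ereal (1 / p)) {M. perfect_matching n M}
     (\<lambda>M. lp_norm d p (\<lambda>k. real (weight (w k) M))) M"
proof -
  let ?g = "\<lambda>M. lp_norm d p (\<lambda>k. real (weight (w k) M))" and ?r = "real d powr real_of_ereal (1 / p)"
  obtain opt where opt: "is_arg_max ?g (\<lambda>M. M \<in> {M. perfect_matching n M}) opt"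
    using ex_is_arg_min_if_finite[OF finite_perfect_matchings, of n "\<lambda>M. - ?g M"] M
    by (auto simp: is_arg_min_def is_arg_max_def)
  then have opt_pm: "perfect_matching n opt" and "?g M \<le> ?g opt"
    using M by (auto simp: is_arg_max_linorder)
  have "0 \<le> real_of_ereal (1 / p)"
    using p by (cases p) (auto simp: one_ereal_def)
  then have r: "1 \<le> ?r" using d by (intro ge_one_powr_ge_zero) auto
  have g: "real (weight (w k) M) \<le> ?g M"
    using component_le_lp_norm[OF p k, of "\<lambda>k. real (weight (w k) M)"] by simp
  have "?g opt \<le> ?r * real (weight (w k) M)"
    using best[OF _ opt_pm] by (intro lp_norm_le_max[OF p d]) simp
  also have "\<dots> \<le> ?r * ?g M" using g r by (intro mult_left_mono) auto
  finally have "?g opt \<le> ?g M * ?r" by (simp only: mult.commute)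
  moreover have "0 < ?r" using r by linarith
  ultimately have "1 / ?r * ?g opt \<le> ?g M" by (simp only: pos_divide_le_eq times_divide_eq_left mult_1_left)
  moreover have "?g M \<le> ?r * ?g opt"
  proof -
    have "0 \<le> ?g M" using g by (rule order_trans[rotated]) simp
    with \<open>?g M \<le> ?g opt\<close> r mult_right_mono[of 1 ?r "?g opt"] show ?thesis by linarith
  qed
  ultimately show ?thesis using M opt unfolding approximative_max_def by blast
qed

section \<open>Input size and polynomial bounds\<close>

lemma weight_le_size:
  assumes "k \<in> {1..d}" "e \<in> edges n"
  shows "w k e \<le> 2 ^ weight_size d n w"
proof (cases "w k e = 0")
  case False
  let ?A = "{nat \<lceil>log 2 (real (w k e))\<rceil> | k e. k \<in> {1..d} \<and> e \<in> edges n}"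
  have "finite ?A" by (rule finite_image_set2) (simp_all add: edges_def)
  then have "nat \<lceil>log 2 (real (w k e))\<rceil> \<le> weight_size d n w"
    unfolding weight_size_def using assms by (intro Max_ge) blast+
  then have "log 2 (real (w k e)) \<le> real (weight_size d n w)" by linarith
  then have "real (w k e) \<le> 2 powr real (weight_size d n w)"
    using False by (simp add: log_le_iff)
  then have "real (w k e) \<le> real (2 ^ weight_size d n w)" by (simp add: powr_realpow)
  then show ?thesis by linarith
qed simp

lemma bounded_input:
  assumes "0 < d" "0 < n"
  shows "bounded_by (d + n + weight_size d n w) (input_state d n w)"
  unfolding bounded_by_def
proof (intro allI)
  fix x a
  let ?b = "d + n + weight_size d n w"
  have mono: "z \<le> 2 ^ ?b" if "z \<le> 2 ^ c" "c \<le> ?b" for z c :: nat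
    using that by (meson order_trans power_increasing one_le_numeral)
  have "d \<le> 2 ^ ?b" using mono[of d d] less_exp[of d] by simp
  moreover have "n \<le> 2 ^ ?b" using mono[of n n] less_exp[of n] by simp
  moreover have "w (m div (n * n) + 1) (m div n mod n + 1, m mod n + 1) \<le> 2 ^ ?b" if "m < d * n * n" for m
  proof -
    have "m div (n * n) < d" using that by (simp add: less_mult_imp_div_less mult.assoc)
    then have "w (m div (n * n) + 1) (m div n mod n + 1, m mod n + 1) \<le> 2 ^ weight_size d n w"
      using assms by (intro weight_le_size) (auto simp: edges_def Suc_le_eq)
    then show ?thesis by (rule mono) simp
  qed
  ultimately have *: "int d \<le> 2 ^ ?b" "int n \<le> 2 ^ ?b"
    "\<And>m. m < d * n * n \<Longrightarrow> int (w (m div (n * n) + 1) (m div n mod n + 1, m mod n + 1)) \<le> 2 ^ ?b"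
    by (simp_all only: of_nat_le_iff[symmetric, where 'a = int] of_nat_power of_nat_numeral)
  moreover have "nat a < d * n * n" if "0 \<le> a" "a < int (d * n * n)" using that by linarith
  ultimately show "\<bar>input_state d n w x a\<bar> \<le> 2 ^ ?b"
    unfolding input_state_def Let_def by auto
qed

lemma triple_sum_product:
  fixes C :: "'a :: comm_semiring_1"
  shows "C * (sum f A * sum g B * sum h E) = (\<Sum>a\<in>A. \<Sum>b\<in>B. \<Sum>e\<in>E. C * (f a * (g b * h e)))"
proof -
  have "sum f A * sum g B * sum h E = sum f A * (\<Sum>b\<in>B. \<Sum>e\<in>E. g b * h e)"
    by (simp only: mult.assoc sum_product[of g B h E])
  also have "\<dots> = (\<Sum>a\<in>A. f a * (\<Sum>b\<in>B. \<Sum>e\<in>E. g b * h e))" by (rule sum_distrib_right)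
  finally show ?thesis by (simp only: sum_distrib_left)
qed

text \<open>
  Powers of \<open>(1 + x) * (1 + y) * (1 + z)\<close> dominate all monomials up to a degree, and their
  expansion follows from the binomial theorem in each variable separately.
\<close>

lemma polynomial3_power:
  "polynomial3 (\<lambda>x y z. C * ((1 + x) * (1 + y) * (1 + z)) ^ D)"
proof -
  have "C * ((1 + x) * (1 + y) * (1 + z)) ^ D =
      (\<Sum>a\<le>D. \<Sum>b\<le>D. \<Sum>e\<le>D. (C * (D choose a) * (D choose b) * (D choose e)) * x ^ a * y ^ b * z ^ e)"
    for x y z :: nat
  proof -
    have b: "(1 + t) ^ D = (\<Sum>a\<le>D. (D choose a) * t ^ a)" for t :: nat
      using binomial[of t 1 D] by (simp add: add.commute)
    have "C * ((1 + x) * (1 + y) * (1 + z)) ^ D =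
      C * ((\<Sum>a\<le>D. (D choose a) * x ^ a) * (\<Sum>a\<le>D. (D choose a) * y ^ a) * (\<Sum>a\<le>D. (D choose a) * z ^ a))"
      by (simp only: power_mult_distrib b)
    also have "\<dots> = (\<Sum>a\<le>D. \<Sum>b\<le>D. \<Sum>e\<le>D.
        C * ((D choose a) * x ^ a * ((D choose b) * y ^ b * ((D choose e) * z ^ e))))"
      by (rule triple_sum_product)
    finally show ?thesis by (simp only: mult_ac)
  qed
  then show ?thesis unfolding polynomial3_def
    by (intro exI[of _ D] exI[of _ "\<lambda>a b e. C * (D choose a) * (D choose b) * (D choose e)"]) (intro ext)
qed

theorem theorem4p2:
  "\<exists>(alg :: com) (P :: nat \<Rightarrow> nat \<Rightarrow> nat \<Rightarrow> nat). polynomial3 P \<and>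
     (\<forall>(d :: nat) (n :: nat) (p :: ereal) (w :: nat \<Rightarrow> nat \<times> nat \<Rightarrow> nat).
        0 < d \<longrightarrow> 0 < n \<longrightarrow> 1 \<le> p \<longrightarrow>
        (\<exists>t q s. exec d (lp_oracle d p) alg (input_state d n w) t q s \<and>
           approximative_max (real d powr real_of_ereal (1 / p))
             {M. perfect_matching n M}
             (\<lambda>M. lp_norm d p (\<lambda>k. real (weight (w k) M)))
             (output_matching n s) \<and>
           t + q \<le> P d n (weight_size d n w)))"
proof -
  obtain K D where KD: "\<And>N. budget N best_matching \<le> K * Suc N ^ D"
    using budget_polynomial[of best_matching] by blast
  \<comment> \<open>With \<open>S = d + n + weight_size d n w + 3\<close>, the budget is at most \<open>K * S ^ D\<close> and the input has at most
    \<open>S\<close> bits, so the cost is at most \<open>K * S ^ D * (S + K * S ^ D)\<close>.\<close>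
  let ?E = "2 * D + 1"
  let ?C = "K * (K + 1) * 3 ^ ?E"
  let ?P = "\<lambda>x y z. ?C * ((1 + x) * (1 + y) * (1 + z)) ^ ?E"
  have "\<exists>t q s. exec d (lp_oracle d p) best_matching (input_state d n w) t q s \<and>
           approximative_max (real d powr real_of_ereal (1 / p))
             {M. perfect_matching n M}
             (\<lambda>M. lp_norm d p (\<lambda>k. real (weight (w k) M)))
             (output_matching n s) \<and>
           t + q \<le> ?P d n (weight_size d n w)"
    if d: "0 < d" and n: "0 < n" and p: "1 \<le> p" for d n p w
  proof -
    let ?s = "input_state d n w" and ?N = "d + n + 2" and ?L = "weight_size d n w"
    let ?f = "?s ''w''" and ?B = "budget ?N best_matching" and ?b = "d + n + ?L"
    have in_n: "?s ''n'' 0 = int n" and in_d: "?s ''d'' 0 = int d" and in_w: "\<And>a. 0 \<le> ?f a"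
      by (simp_all add: input_state_def Let_def)
    have "wp ?N best_matching (\<lambda>s'. \<exists>q. bij_betw q {1..int n} {1..int n} \<and>
        (\<forall>j\<in>{1..int n}. s' ''m'' (q j) = j) \<and>
        (\<exists>k\<in>{1..int d}. \<forall>k'\<in>{1..int d}. \<forall>q'. bij_betw q' {1..int n} {1..int n} \<longrightarrow>
           total ?f (int n) k' q' \<le> total ?f (int n) k q)) ?s"
      using wp_best_matching[of ?s ?N] d in_w unfolding in_n in_d by simp
    from wp_imp_exec[OF additive_best_matching this bounded_input[OF d n], of d "lp_oracle d p"]
    obtain t q s where run: "exec d (lp_oracle d p) best_matching ?s t q s"
      and found: "\<exists>m. bij_betw m {1..int n} {1..int n} \<and> (\<forall>j\<in>{1..int n}. s ''m'' (m j) = j) \<and>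
        (\<exists>k\<in>{1..int d}. \<forall>k'\<in>{1..int d}. \<forall>q'. bij_betw q' {1..int n} {1..int n} \<longrightarrow>
           total ?f (int n) k' q' \<le> total ?f (int n) k m)"
      and time: "t + q \<le> ?B * (?b + ?B)"
      by blast
    from found obtain m where m: "bij_betw m {1..int n} {1..int n}"
        "\<And>j. j \<in> {1..int n} \<Longrightarrow> s ''m'' (m j) = j"
      and best: "\<exists>k\<in>{1..int d}. \<forall>k'\<in>{1..int d}. \<forall>q'. bij_betw q' {1..int n} {1..int n} \<longrightarrow>
           total ?f (int n) k' q' \<le> total ?f (int n) k m"
      by blast
    from best obtain k0 where k0: "k0 \<in> {1..int d}"
      and k0_best: "\<And>k' q'. k' \<in> {1..int d} \<Longrightarrow> bij_betw q' {1..int n} {1..int n} \<Longrightarrow>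
         total ?f (int n) k' q' \<le> total ?f (int n) k0 m" by blast
    define k where "k = nat k0"
    have k: "k \<in> {1..d}" "k0 = int k" using k0 by (auto simp: k_def)
    have out: "output_matching n s = matching_of n m" using m by (rule output_matching_eq)
    have "weight (w k') M' \<le> weight (w k) (matching_of n m)"
      if k': "k' \<in> {1..d}" and M': "perfect_matching n M'" for k' M'
    proof -
      obtain q' where q': "bij_betw q' {1..int n} {1..int n}" "M' = matching_of n q'"
        using perfect_matching_is_matching_of[OF M'] .
      have "total ?f (int n) (int k') q' \<le> total ?f (int n) (int k) m"
        using k0_best[of "int k'" q'] q' k' k by simp
      then show ?thesis
        using total_input[OF k' q'(1)] total_input[OF k(1) m(1)] q'(2) by simp
    qed
    then have approx: "approximative_max (real d powr real_of_ereal (1 / p)) {M. perfect_matching n M}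
        (\<lambda>M. lp_norm d p (\<lambda>k. real (weight (w k) M))) (output_matching n s)"
      unfolding out by (rule approximative_max_best_component[OF p d perfect_matching_matching_of[OF m(1)] k(1)])
    have "t + q \<le> ?P d n ?L"
    proof -
      define S where "S = d + n + ?L + 3"
      have "Suc ?N ^ D \<le> S ^ D" by (rule power_mono) (auto simp: S_def)
      then have B: "?B \<le> K * S ^ D" using KD[of ?N] by (meson mult_left_mono order_trans zero_le)
      have "S * 1 \<le> S * S ^ D" by (rule mult_le_mono2) (simp add: S_def)
      moreover have "?b \<le> S * 1" by (simp add: S_def)
      ultimately have "?b \<le> S * S ^ D" by (rule order_trans[rotated])
      moreover have "S ^ D \<le> S * S ^ D" by (simp add: S_def)
      then have "?B \<le> K * (S * S ^ D)" using B mult_le_mono2 order_trans by blast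
      ultimately have "?b + ?B \<le> (K + 1) * (S * S ^ D)" by (simp add: add_mult_distrib)
      with B have "?B * (?b + ?B) \<le> (K * S ^ D) * ((K + 1) * (S * S ^ D))" by (rule mult_le_mono)
      also have "\<dots> = K * (K + 1) * S ^ ?E"
        unfolding mult_2 power_add power_one_right by (simp only: mult_ac)
      also have "\<dots> \<le> K * (K + 1) * (3 * ((1 + d) * (1 + n) * (1 + ?L))) ^ ?E"
      proof (intro mult_le_mono2 power_mono)
        show "S \<le> 3 * ((1 + d) * (1 + n) * (1 + ?L))" by (simp add: S_def algebra_simps)
      qed simp
      also have "\<dots> = ?P d n ?L" by (simp only: power_mult_distrib mult_ac)
      finally show ?thesis using time by linarith
    qed
    with run approx show ?thesis by blast
  qed
  then show ?thesis
    using polynomial3_power[of ?C ?E] by (intro exI[of _ best_matching] exI[of _ ?P]) blast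
qed

end
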